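(* Let $d>2$ and let $\Sigma\subset\mathbb{R}^d$ be any $C^2$-smooth strictly convex hypersurface with positive curvature. Then for every point $x\in\Sigma$ there exist infinitely many billiard configurations $\{x_n\}_{n\ge 0}$ in $\Sigma$ starting at $x_0=x$ along which there is a point conjugate to the starting point, i.e. such that $x_0$ and $x_N$ are conjugate for some $N>0$.
   Context: $\Sigma$ is the (compact) boundary of the convex billiard table in $\mathbb{R}^d$; positive curvature means that the second fundamental form with respect to the inward unit normal is positive definite at every point. Let $L(x,y)=|x-y|$ be the Euclidean distance. A billiard configuration is a sequence of points $x_n\in\Sigma$ (indexed by an interval of integers, finite or infinite), with $x_n\ne x_{n+1}$, which obeys the billiard reflection law at every point having both neighbours; equivalently, for all integers $M\le N$ such that $M-1,\dots,N+1$ lie in the index set, $(x_M,\dots,x_N)$ is a critical point of the function $$\Phi_{M,N}(u_M,\dots,u_N)=L(x_{M-1},u_M)+\sum_{i=M}^{N-1}L(u_i,u_{i+1})+L(u_N,x_{N+1})$$ of $(u_M,\dots,u_N)\in\Sigma^{N-M+1}$. A Jacobi field along a billiard configuration $\{x_n\}$ is a sequence of tangent vectors $\xi_n\in T_{x_n}\Sigma$ that arises as a variation field $\xi_n=\frac{d}{d\varepsilon}\big|_{\varepsilon=0}x_n(\varepsilon)$ of a one-parameter family of billiard configurations $\{x_n(\varepsilon)\}$ with $x_n(0)=x_n$. Two points $x_M,x_N$ ($M<N$) of a billiard configuration are called conjugate if there is a Jacobi field along it, not identically zero, with $\xi_M=0$ and $\xi_N=0$. *)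

theory Defs
  imports "HOL-Analysis.Analysis"
begin

definition C1_on :: "'a::real_normed_vector set \<Rightarrow> ('a \<Rightarrow> 'b::real_normed_vector) \<Rightarrow> bool" where
  "C1_on U f \<longleftrightarrow> (\<exists>f' :: 'a \<Rightarrow> 'a \<Rightarrow>\<^sub>L 'b.
     (\<forall>q\<in>U. (f has_derivative blinfun_apply (f' q)) (at q)) \<and> continuous_on U f')"

definition C2_on :: "'a::real_normed_vector set \<Rightarrow> ('a \<Rightarrow> 'b::real_normed_vector) \<Rightarrow> bool" where
  "C2_on U f \<longleftrightarrow> (\<exists>f' :: 'a \<Rightarrow> 'a \<Rightarrow>\<^sub>L 'b.
     (\<forall>q\<in>U. (f has_derivative blinfun_apply (f' q)) (at q)) \<and> C1_on U f')"

text \<open>Embedded hypersurfaces, given locally as regular level sets.\<close>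

definition C2_hypersurface :: "'a::euclidean_space set \<Rightarrow> bool" where
  "C2_hypersurface S \<longleftrightarrow> (\<forall>p\<in>S. \<exists>U (f :: 'a \<Rightarrow> real). open U \<and> p \<in> U \<and> C2_on U f \<and>
     (\<forall>q\<in>U. \<not> (f has_derivative (\<lambda>_. 0)) (at q)) \<and> S \<inter> U = {q \<in> U. f q = 0})"

text \<open>A (filled) billiard table; the hypersurface of the theory is its frontier.\<close>

definition strictly_convex_body :: "'a::euclidean_space set \<Rightarrow> bool" where
  "strictly_convex_body K \<longleftrightarrow> compact K \<and> convex K \<and> interior K \<noteq> {} \<and>
     (\<forall>p\<in>frontier K. \<forall>q\<in>frontier K. p \<noteq> q \<longrightarrow> open_segment p q \<subseteq> interior K)"

definition tangent_space :: "'a::euclidean_space set \<Rightarrow> 'a \<Rightarrow> 'a set" where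
  "tangent_space S p = {v. \<exists>\<gamma> :: real \<Rightarrow> 'a.
     (\<forall>t. \<gamma> t \<in> S) \<and> \<gamma> 0 = p \<and> (\<gamma> has_vector_derivative v) (at 0)}"

definition inward_unit_normal :: "'a::euclidean_space set \<Rightarrow> 'a \<Rightarrow> 'a" where
  "inward_unit_normal K p = (THE n. norm n = 1 \<and>
     (\<forall>v\<in>tangent_space (frontier K) p. n \<bullet> v = 0) \<and>
     (\<forall>\<^sub>F t in at_right 0. p + t *\<^sub>R n \<in> K))"

text \<open>
  The second fundamental form \<open>II\<^sub>p(v,w) = - d\<nu>\<^sub>p(v) \<bullet> w\<close> of the frontier with respect to the
  inward unit normal field \<open>\<nu>\<close>. The normal field lives on the frontier only, so the derivative is
  taken within it; such a derivative is not unique on the whole space, but its values on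
  tangent vectors are, and these are the only ones used below.
\<close>

definition second_fundamental_form :: "'a::euclidean_space set \<Rightarrow> 'a \<Rightarrow> 'a \<Rightarrow> 'a \<Rightarrow> real" where
  "second_fundamental_form K p v w =
     - (frechet_derivative (inward_unit_normal K) (at p within frontier K) v \<bullet> w)"

definition positive_curvature :: "'a::euclidean_space set \<Rightarrow> bool" where
  "positive_curvature K \<longleftrightarrow> (\<forall>p\<in>frontier K. \<forall>v\<in>tangent_space (frontier K) p.
     v \<noteq> 0 \<longrightarrow> second_fundamental_form K p v v > 0)"

text \<open>
  \<open>u\<close>, restricted to the finite index set \<open>I\<close>, is a critical point of \<open>F\<close> on the product
  \<open>S\<^sup>I\<close>: the derivative of \<open>F\<close> vanishes along every curve in \<open>S\<^sup>I\<close> through \<open>u\<close>. It is meant for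
  functions \<open>F\<close> that depend on the coordinates in \<open>I\<close> only.
\<close>

definition critical_point_on ::
    "'a::euclidean_space set \<Rightarrow> nat set \<Rightarrow> ((nat \<Rightarrow> 'a) \<Rightarrow> real) \<Rightarrow> (nat \<Rightarrow> 'a) \<Rightarrow> bool" where
  "critical_point_on S I F u \<longleftrightarrow> (\<forall>i\<in>I. u i \<in> S) \<and>
     (\<forall>c :: real \<Rightarrow> nat \<Rightarrow> 'a.
        (\<forall>i\<in>I. (\<forall>t. c t i \<in> S) \<and> c 0 i = u i \<and> (\<lambda>t. c t i) differentiable (at 0))
        \<longrightarrow> ((\<lambda>t. F (c t)) has_real_derivative 0) (at 0))"

definition billiard_length ::
    "(nat \<Rightarrow> 'a::euclidean_space) \<Rightarrow> nat \<Rightarrow> nat \<Rightarrow> (nat \<Rightarrow> 'a) \<Rightarrow> real" where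
  "billiard_length X M N u =
     dist (X (M - 1)) (u M) + (\<Sum>i = M..<N. dist (u i) (u (i + 1))) + dist (u N) (X (N + 1))"

text \<open>Billiard configurations indexed by \<open>n \<ge> 0\<close>; the reflection law holds from \<open>n = 1\<close> on.\<close>

definition billiard_configuration :: "'a::euclidean_space set \<Rightarrow> (nat \<Rightarrow> 'a) \<Rightarrow> bool" where
  "billiard_configuration S X \<longleftrightarrow> (\<forall>n. X n \<in> S) \<and> (\<forall>n. X n \<noteq> X (n + 1)) \<and>
     (\<forall>M N. 1 \<le> M \<and> M \<le> N \<longrightarrow> critical_point_on S {M..N} (billiard_length X M N) X)"

definition jacobi_field ::
    "'a::euclidean_space set \<Rightarrow> (nat \<Rightarrow> 'a) \<Rightarrow> (nat \<Rightarrow> 'a) \<Rightarrow> bool" where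
  "jacobi_field S X \<xi> \<longleftrightarrow> (\<forall>n. \<xi> n \<in> tangent_space S (X n)) \<and>
     (\<exists>\<delta>>0. \<exists>Y :: real \<Rightarrow> nat \<Rightarrow> 'a.
        (\<forall>\<epsilon>\<in>{-\<delta><..<\<delta>}. billiard_configuration S (Y \<epsilon>)) \<and> Y 0 = X \<and>
        (\<forall>n. (\<lambda>\<epsilon>. Y \<epsilon> n) C1_differentiable_on {-\<delta><..<\<delta>} \<and>
             ((\<lambda>\<epsilon>. Y \<epsilon> n) has_vector_derivative \<xi> n) (at 0)))"

definition conjugate_points ::
    "'a::euclidean_space set \<Rightarrow> (nat \<Rightarrow> 'a) \<Rightarrow> nat \<Rightarrow> nat \<Rightarrow> bool" where
  "conjugate_points S X M N \<longleftrightarrow> M < N \<and>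
     (\<exists>\<xi>. jacobi_field S X \<xi> \<and> (\<exists>n. \<xi> n \<noteq> 0) \<and> \<xi> M = 0 \<and> \<xi> N = 0)"

end

theory Submission
  imports Defs
begin

text \<open>
  Write \<open>\<Sigma>\<close> for the frontier of \<open>K\<close>. A billiard trajectory that starts at \<open>x\<close> is determined by its
  second point \<open>u\<close>: it is \<open>orbit x u\<close>, and distinct \<open>u\<close> give distinct configurations. Let
  \<open>z = bounce x u\<close> be the point that follows \<open>u\<close>. By the reflection law \<open>u\<close> is a critical point of
  \<open>p \<mapsto> |x - p| + |p - z|\<close> on \<open>\<Sigma>\<close>; let \<open>H\<^sub>u\<close> be the Hessian of this function at \<open>u\<close>
  (\<open>length_hessian\<close>), a symmetric bilinear form on the tangent space at \<open>u\<close>. Linearising the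
  reflection law shows that the Jacobi field with \<open>\<xi>\<^sub>0 = 0\<close> and \<open>\<xi>\<^sub>1 = v\<close> has \<open>\<xi>\<^sub>2 = 0\<close> as soon as
  \<open>v\<close> lies in the kernel of \<open>H\<^sub>u\<close> (\<open>conjugate_points_of_kernel\<close>). So it is enough that \<open>H\<^sub>u\<close> is
  degenerate for infinitely many \<open>u\<close>.

  Two observations force this. If \<open>u\<close> is close to \<open>x\<close>, then \<open>H\<^sub>u\<close> is positive on some tangent
  vector: in dimension at least three there is a tangent vector orthogonal to the chord from \<open>x\<close>
  to \<open>u\<close>, and on it the term \<open>1 / |u - x|\<close> outweighs the bounded curvature term
  (\<open>positive_direction_exists\<close>). On the other hand, for every \<open>y \<noteq> x\<close> in \<open>\<Sigma>\<close> a point \<open>u\<close> at which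
  \<open>|x - p| + |p - y|\<close> is maximal satisfies \<open>bounce x u = y\<close> and has \<open>H\<^sub>u \<le> 0\<close>
  (\<open>length_maximizer\<close>); as \<open>y\<close> varies, these are infinitely many points.

  Let \<open>P\<close> be the set of \<open>u \<noteq> x\<close> at which \<open>H\<^sub>u\<close> takes a positive value, and \<open>N\<close> the set of those at
  which it is negative definite. Both are open in \<open>\<Sigma> - {x}\<close> and they are disjoint. At any other
  \<open>u\<close> the form is negative semidefinite with a nonzero null vector, which by symmetry lies in its
  kernel. Suppose that there are only finitely many such \<open>u\<close>. Then \<open>N\<close> is not empty, because
  infinitely many maximisers lie outside \<open>P\<close>; and \<open>\<Sigma> - {x}\<close>, a Euclidean space of dimension at
  least two up to homeomorphism, remains connected when the finitely many exceptional points are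
  removed. It would then be the disjoint union of the nonempty open sets \<open>P\<close> and \<open>N\<close>, which is
  absurd (\<open>infinite_conjugate_orbits\<close>).

  The analytic basis consists of two facts. The inner unit normal is locally the restriction of a
  \<open>C\<^sup>1\<close> field whose derivative is symmetric on tangent vectors (\<open>normal_extension\<close>). The point at
  which a line crosses \<open>\<Sigma>\<close> transversally is a \<open>C\<^sup>1\<close> function of the line (\<open>boundary_hit\<close>). By
  strict convexity every segment of a trajectory is transversal to \<open>\<Sigma>\<close>, so a \<open>C\<^sup>1\<close> variation of
  the second point extends to a variation through infinite configurations, as the definition of a
  Jacobi field demands.
\<close>

section \<open>Symmetry of second derivatives\<close>

text \<open>
  The second difference in the directions \<open>v\<close>, \<open>w\<close> is symmetric in them, while the mean value
  theorem along \<open>v\<close> approximates it by the derivative of the gradient in the direction \<open>w\<close>.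
  Exchanging the roles of the directions then proves symmetry at any point where the gradient is
  differentiable.
\<close>

lemma second_difference_estimate:
  fixes f :: "'a::real_inner \<Rightarrow> real"
  assumes "open U" "p \<in> U"
    and f: "\<And>q. q \<in> U \<Longrightarrow> (f has_derivative (\<lambda>v. g q \<bullet> v)) (at q)"
    and g: "(g has_derivative G) (at p)"
    and "e > 0"
  shows "\<exists>d>0. \<forall>t. 0 < t \<and> t < d \<longrightarrow>
    \<bar>f (p + t *\<^sub>R v + t *\<^sub>R w) - f (p + t *\<^sub>R v) - f (p + t *\<^sub>R w) + f p - t\<^sup>2 * (G w \<bullet> v)\<bar> \<le> e * t\<^sup>2"
proof -
  interpret G: bounded_linear G using g by (rule has_derivative_bounded_linear)
  define c where "c = norm v + norm w + 1"
  have c: "c > 0" unfolding c_def by (smt (verit) norm_ge_zero)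
  (* two remainders of the gradient, each at distance at most t * c from p, paired with v of norm at most c *)
  define e' where "e' = e / (2 * c * c)"
  have e': "e' > 0" using c \<open>e > 0\<close> by (simp add: e'_def)
  obtain r where r: "r > 0" "ball p r \<subseteq> U" using assms(1,2) by (meson openE)
  obtain s where s: "s > 0" "\<And>y. norm (y - p) < s \<Longrightarrow> norm (g y - g p - G (y - p)) \<le> e' * norm (y - p)"
    using g e' unfolding has_derivative_at_alt by blast
  define d where "d = min r s / c"
  have d: "d > 0" using r s c by (simp add: d_def)
  have "\<bar>f (p + t *\<^sub>R v + t *\<^sub>R w) - f (p + t *\<^sub>R v) - f (p + t *\<^sub>R w) + f p - t\<^sup>2 * (G w \<bullet> v)\<bar> \<le> e * t\<^sup>2"
    if t: "0 < t" "t < d" for t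
  proof -
    have tc: "t * c < min r s" using t c by (simp add: d_def pos_less_divide_eq)
    have nb: "norm (a *\<^sub>R v + b *\<^sub>R w) \<le> t * c" if "0 \<le> a" "a \<le> t" "0 \<le> b" "b \<le> t" for a b
    proof -
      have "norm (a *\<^sub>R v + b *\<^sub>R w) \<le> a * norm v + b * norm w"
        using that by (metis abs_of_nonneg norm_scaleR norm_triangle_ineq)
      also have "\<dots> \<le> t * norm v + t * norm w"
        using that by (intro add_mono mult_right_mono) auto
      also have "\<dots> \<le> t * c" using t by (simp add: c_def algebra_simps)
      finally show ?thesis .
    qed
    have inU: "p + a *\<^sub>R v + b *\<^sub>R w \<in> U" if "0 \<le> a" "a \<le> t" "0 \<le> b" "b \<le> t" for a b
    proof -
      have "norm (a *\<^sub>R v + b *\<^sub>R w) < r" using nb[OF that] tc by linarith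
      then have "p + a *\<^sub>R v + b *\<^sub>R w \<in> ball p r"
        by (metis add.assoc add_diff_cancel_left' dist_norm dist_commute mem_ball)
      then show ?thesis using r by blast
    qed
    have est: "norm (g (p + a *\<^sub>R v + b *\<^sub>R w) - g p - G (a *\<^sub>R v + b *\<^sub>R w)) \<le> e' * (t * c)"
      if "0 \<le> a" "a \<le> t" "0 \<le> b" "b \<le> t" for a b
    proof -
      have "norm (a *\<^sub>R v + b *\<^sub>R w) < s" using nb[OF that] tc by linarith
      then have "norm (g (p + a *\<^sub>R v + b *\<^sub>R w) - g p - G (a *\<^sub>R v + b *\<^sub>R w)) \<le> e' * norm (a *\<^sub>R v + b *\<^sub>R w)"
        using s(2)[of "p + a *\<^sub>R v + b *\<^sub>R w"] by (simp add: add.assoc)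
      also have "\<dots> \<le> e' * (t * c)" using nb[OF that] e' by simp
      finally show ?thesis .
    qed
    define h where "h x = f (p + x *\<^sub>R v + t *\<^sub>R w) - f (p + x *\<^sub>R v)" for x
    have "\<exists>x\<in>{0..t}. h t - h 0 = (t - 0) * ((g (p + x *\<^sub>R v + t *\<^sub>R w) - g (p + x *\<^sub>R v)) \<bullet> v)"
    proof (rule mvt_very_simple)
      show "0 \<le> t" using t by simp
      fix x assume x: "0 \<le> x" "x \<le> t"
      have 1: "(f has_derivative (\<lambda>u. g (p + x *\<^sub>R v + t *\<^sub>R w) \<bullet> u)) (at (p + x *\<^sub>R v + t *\<^sub>R w))"
        using f inU[of x t] x t by auto
      have 2: "(f has_derivative (\<lambda>u. g (p + x *\<^sub>R v) \<bullet> u)) (at (p + x *\<^sub>R v))"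
        using f inU[of x 0] x t by auto
      have "((\<lambda>x. f (p + x *\<^sub>R v + t *\<^sub>R w)) has_derivative (\<lambda>y. g (p + x *\<^sub>R v + t *\<^sub>R w) \<bullet> (y *\<^sub>R v))) (at x)"
        by (rule has_derivative_compose[where g=f and f="\<lambda>x. p + x *\<^sub>R v + t *\<^sub>R w" and f'="\<lambda>y. y *\<^sub>R v", OF _ 1]) (auto intro!: derivative_eq_intros)
      moreover have "((\<lambda>x. f (p + x *\<^sub>R v)) has_derivative (\<lambda>y. g (p + x *\<^sub>R v) \<bullet> (y *\<^sub>R v))) (at x)"
        by (rule has_derivative_compose[where g=f and f="\<lambda>x. p + x *\<^sub>R v" and f'="\<lambda>y. y *\<^sub>R v", OF _ 2]) (auto intro!: derivative_eq_intros)
      ultimately have "(h has_derivative (\<lambda>y. g (p + x *\<^sub>R v + t *\<^sub>R w) \<bullet> (y *\<^sub>R v) - g (p + x *\<^sub>R v) \<bullet> (y *\<^sub>R v))) (at x)"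
        unfolding h_def by (rule has_derivative_diff)
      moreover have "(\<lambda>y. g (p + x *\<^sub>R v + t *\<^sub>R w) \<bullet> (y *\<^sub>R v) - g (p + x *\<^sub>R v) \<bullet> (y *\<^sub>R v))
          = (\<lambda>y. y * ((g (p + x *\<^sub>R v + t *\<^sub>R w) - g (p + x *\<^sub>R v)) \<bullet> v))"
        by (rule ext) (simp add: inner_diff_left right_diff_distrib)
      ultimately show "(h has_derivative (\<lambda>y. y * ((g (p + x *\<^sub>R v + t *\<^sub>R w) - g (p + x *\<^sub>R v)) \<bullet> v))) (at x within {0..t})"
        by (metis has_derivative_at_withinI)
    qed
    then obtain x where x: "0 \<le> x" "x \<le> t"
      and hx: "h t - h 0 = t * ((g (p + x *\<^sub>R v + t *\<^sub>R w) - g (p + x *\<^sub>R v)) \<bullet> v)" by auto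
    define R1 where "R1 = g (p + x *\<^sub>R v + t *\<^sub>R w) - g p - G (x *\<^sub>R v + t *\<^sub>R w)"
    define R2 where "R2 = g (p + x *\<^sub>R v) - g p - G (x *\<^sub>R v)"
    have R: "norm R1 \<le> e' * (t * c)" "norm R2 \<le> e' * (t * c)"
      using est[of x t] est[of x 0] x t by (auto simp: R1_def R2_def)
    have "g (p + x *\<^sub>R v + t *\<^sub>R w) - g (p + x *\<^sub>R v) = t *\<^sub>R G w + (R1 - R2)"
      by (simp add: R1_def R2_def G.add G.scaleR)
    then have "h t - h 0 = t * ((t *\<^sub>R G w + (R1 - R2)) \<bullet> v)"
      using hx by (simp only:)
    then have "h t - h 0 - t\<^sup>2 * (G w \<bullet> v) = t * ((R1 - R2) \<bullet> v)"
      by (simp add: inner_add_left power2_eq_square algebra_simps)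
    moreover have "\<bar>(R1 - R2) \<bullet> v\<bar> \<le> (2 * e' * (t * c)) * c"
    proof -
      have "\<bar>(R1 - R2) \<bullet> v\<bar> \<le> norm (R1 - R2) * norm v" by (rule Cauchy_Schwarz_ineq2)
      also have "\<dots> \<le> (2 * e' * (t * c)) * c"
      proof (rule mult_mono)
        show "norm (R1 - R2) \<le> 2 * e' * (t * c)" using R norm_triangle_ineq4[of R1 R2] by linarith
        show "norm v \<le> c" by (simp add: c_def)
        show "0 \<le> 2 * e' * (t * c)" using e' t c by simp
      qed simp
      finally show ?thesis .
    qed
    ultimately have "\<bar>h t - h 0 - t\<^sup>2 * (G w \<bullet> v)\<bar> \<le> t * ((2 * e' * (t * c)) * c)"
      using t by (simp add: abs_mult)
    also have "\<dots> = e * t\<^sup>2" using c by (simp add: e'_def power2_eq_square)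
    finally show ?thesis by (simp add: h_def algebra_simps)
  qed
  then show ?thesis using d by blast
qed

lemma derivative_of_gradient_symmetric:
  fixes f :: "'a::real_inner \<Rightarrow> real"
  assumes "open U" "p \<in> U"
    and f: "\<And>q. q \<in> U \<Longrightarrow> (f has_derivative (\<lambda>v. g q \<bullet> v)) (at q)"
    and g: "(g has_derivative G) (at p)"
  shows "G v \<bullet> w = G w \<bullet> v"
proof -
  have "\<bar>G v \<bullet> w - G w \<bullet> v\<bar> \<le> e" if "e > 0" for e
  proof -
    have e2: "e / 2 > 0" using that by simp
    obtain d1 where d1: "d1 > 0" "\<And>t. 0 < t \<and> t < d1 \<Longrightarrow>
      \<bar>f (p + t *\<^sub>R v + t *\<^sub>R w) - f (p + t *\<^sub>R v) - f (p + t *\<^sub>R w) + f p - t\<^sup>2 * (G w \<bullet> v)\<bar> \<le> e / 2 * t\<^sup>2"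
      using second_difference_estimate[OF assms e2, of v w] by auto
    obtain d2 where d2: "d2 > 0" "\<And>t. 0 < t \<and> t < d2 \<Longrightarrow>
      \<bar>f (p + t *\<^sub>R w + t *\<^sub>R v) - f (p + t *\<^sub>R w) - f (p + t *\<^sub>R v) + f p - t\<^sup>2 * (G v \<bullet> w)\<bar> \<le> e / 2 * t\<^sup>2"
      using second_difference_estimate[OF assms e2, of w v] by auto
    define t where "t = min d1 d2 / 2"
    have t: "0 < t" "t < d1" "t < d2" using d1(1) d2(1) by (auto simp: t_def)
    have "\<bar>t\<^sup>2 * (G v \<bullet> w) - t\<^sup>2 * (G w \<bullet> v)\<bar> \<le> e * t\<^sup>2"
    proof -
      define A where "A = f (p + t *\<^sub>R v + t *\<^sub>R w) - f (p + t *\<^sub>R v) - f (p + t *\<^sub>R w) + f p"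
      have swap: "p + t *\<^sub>R w + t *\<^sub>R v = p + t *\<^sub>R v + t *\<^sub>R w" by simp
      have "A = f (p + t *\<^sub>R w + t *\<^sub>R v) - f (p + t *\<^sub>R w) - f (p + t *\<^sub>R v) + f p"
        unfolding A_def swap by linarith
      then have "\<bar>A - t\<^sup>2 * (G v \<bullet> w)\<bar> \<le> e / 2 * t\<^sup>2" using d2(2)[of t] t by simp
      moreover have "\<bar>A - t\<^sup>2 * (G w \<bullet> v)\<bar> \<le> e / 2 * t\<^sup>2" using d1(2)[of t] t by (simp add: A_def)
      moreover have "e * t\<^sup>2 = e / 2 * t\<^sup>2 + e / 2 * t\<^sup>2" by simp
      ultimately show ?thesis by linarith
    qed
    then have "t\<^sup>2 * \<bar>G v \<bullet> w - G w \<bullet> v\<bar> \<le> t\<^sup>2 * e"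
      by (simp add: abs_mult flip: right_diff_distrib) (simp add: mult.commute)
    then show ?thesis using t by (simp add: mult_le_cancel_left_pos)
  qed
  then have "\<bar>G v \<bullet> w - G w \<bullet> v\<bar> \<le> 0" by (rule field_le_epsilon[where y=0, simplified])
  then show ?thesis by simp
qed

section \<open>Differentiable curves\<close>

lemma has_vector_derivative_imp_continuous_on:
  "(\<And>t. t \<in> I \<Longrightarrow> (f has_vector_derivative f' t) (at t)) \<Longrightarrow> continuous_on I f"
  by (meson continuous_at_imp_continuous_on has_vector_derivative_continuous)

text \<open>
  This makes it possible to prove regularity of the billiard map along a curve in local charts
  while keeping one parameter interval for all points of a trajectory.
\<close>

lemma C1_differentiable_on_locally:
  assumes "\<And>t. t \<in> I \<Longrightarrow> \<exists>J. open J \<and> t \<in> J \<and> f C1_differentiable_on J"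
  shows "f C1_differentiable_on I"
  unfolding C1_differentiable_on_eq
proof (intro conjI ballI continuous_at_imp_continuous_on)
  fix t assume "t \<in> I"
  then obtain J where J: "open J" "t \<in> J" "f C1_differentiable_on J" using assms by blast
  show "f differentiable at t" using J unfolding C1_differentiable_on_eq by blast
  show "isCont (\<lambda>t. vector_derivative f (at t)) t"
    using J unfolding C1_differentiable_on_eq by (metis continuous_on_eq_continuous_at)
qed

lemma C1_differentiable_on_cong:
  assumes "open I" "f C1_differentiable_on I" "\<And>t. t \<in> I \<Longrightarrow> f t = g t"
  shows "g C1_differentiable_on I"
proof -
  obtain D where D: "\<And>t. t \<in> I \<Longrightarrow> (f has_vector_derivative D t) (at t)" "continuous_on I D"
    using assms(2) unfolding C1_differentiable_on_def by blast
  have "(g has_vector_derivative D t) (at t)" if "t \<in> I" for t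
    by (rule has_vector_derivative_transform_within_open[OF D(1)[OF that] assms(1) that assms(3)])
  then show ?thesis using D(2) unfolding C1_differentiable_on_def by blast
qed

lemma C1_differentiable_on_inner:
  fixes f g :: "real \<Rightarrow> 'a::real_inner"
  assumes "f C1_differentiable_on I" "g C1_differentiable_on I"
  shows "(\<lambda>t. f t \<bullet> g t) C1_differentiable_on I"
proof -
  obtain F where F: "\<And>t. t \<in> I \<Longrightarrow> (f has_vector_derivative F t) (at t)" "continuous_on I F"
    using assms(1) unfolding C1_differentiable_on_def by blast
  obtain G where G: "\<And>t. t \<in> I \<Longrightarrow> (g has_vector_derivative G t) (at t)" "continuous_on I G"
    using assms(2) unfolding C1_differentiable_on_def by blast
  have "continuous_on I f" "continuous_on I g"
    by (rule has_vector_derivative_imp_continuous_on, erule F(1) G(1))+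
  then have "continuous_on I (\<lambda>t. f t \<bullet> G t + F t \<bullet> g t)" using F(2) G(2) by (intro continuous_intros)
  moreover have "((\<lambda>t. f t \<bullet> g t) has_vector_derivative (f t \<bullet> G t + F t \<bullet> g t)) (at t)" if "t \<in> I" for t
    by (rule bounded_bilinear.has_vector_derivative[OF bounded_bilinear_inner F(1)[OF that] G(1)[OF that]])
  ultimately show ?thesis
    unfolding C1_differentiable_on_def by (intro exI[of _ "\<lambda>t. f t \<bullet> G t + F t \<bullet> g t"]) simp
qed

lemma has_vector_derivative_dist:
  fixes f g :: "real \<Rightarrow> 'a::real_inner"
  assumes f: "(f has_vector_derivative f') (at t)" and g: "(g has_vector_derivative g') (at t)" and ne: "f t \<noteq> g t"
  shows "((\<lambda>t. dist (f t) (g t)) has_real_derivative sgn (g t - f t) \<bullet> (g' - f')) (at t)"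
proof -
  have d: "((\<lambda>t. g t - f t) has_vector_derivative (g' - f')) (at t)"
    using f g by (rule has_vector_derivative_diff[rotated])
  have "(norm has_derivative (\<lambda>h. h \<bullet> sgn (g t - f t))) (at (g t - f t))"
    using has_derivative_norm[of "g t - f t"] ne by (simp add: inner_commute)
  from vector_derivative_diff_chain_within[OF d has_derivative_at_withinI[OF this]]
  show ?thesis
    by (simp add: o_def dist_norm norm_minus_commute inner_commute has_real_derivative_iff_has_vector_derivative)
qed

text \<open>
  The unit vector \<open>sgn (f t)\<close> moves orthogonally to itself.
\<close>

lemma has_vector_derivative_sgn:
  fixes f :: "real \<Rightarrow> 'a::real_inner"
  assumes f: "(f has_vector_derivative f') (at t)" and ne: "f t \<noteq> 0"
  shows "((\<lambda>t. sgn (f t)) has_vector_derivative (f' - (sgn (f t) \<bullet> f') *\<^sub>R sgn (f t)) /\<^sub>R norm (f t)) (at t)"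
proof -
  have "((\<lambda>t. dist 0 (f t)) has_real_derivative sgn (f t - 0) \<bullet> (f' - 0)) (at t)"
    by (rule has_vector_derivative_dist[OF has_vector_derivative_const f]) (use ne in auto)
  then have n: "((\<lambda>t. norm (f t)) has_real_derivative sgn (f t) \<bullet> f') (at t)" by simp
  have i: "((\<lambda>t. inverse (norm (f t))) has_real_derivative - (inverse (norm (f t)) * (sgn (f t) \<bullet> f') * inverse (norm (f t)))) (at t)"
    using DERIV_inverse'[OF n] ne by simp
  have "((\<lambda>t. inverse (norm (f t)) *\<^sub>R f t) has_vector_derivative
     (inverse (norm (f t)) *\<^sub>R f' + (- (inverse (norm (f t)) * (sgn (f t) \<bullet> f') * inverse (norm (f t)))) *\<^sub>R f t)) (at t)"
    by (rule has_vector_derivative_scaleR[OF i f])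
  moreover have "inverse (norm (f t)) *\<^sub>R f' + (- (inverse (norm (f t)) * (sgn (f t) \<bullet> f') * inverse (norm (f t)))) *\<^sub>R f t
     = (f' - (sgn (f t) \<bullet> f') *\<^sub>R sgn (f t)) /\<^sub>R norm (f t)"
    by (simp add: sgn_div_norm scaleR_diff_right divide_inverse mult.assoc mult.left_commute)
  ultimately show ?thesis by (simp add: sgn_div_norm[abs_def])
qed

lemma has_vector_derivative_quotient_tendsto:
  assumes "(f has_vector_derivative D) (at 0)"
  shows "((\<lambda>t. (f t - f 0) /\<^sub>R t) \<longlongrightarrow> D) (at 0)"
proof -
  have "((\<lambda>t. norm (f (0 + t) - f 0 - t *\<^sub>R D) / norm t) \<longlongrightarrow> 0) (at 0)"
    using assms unfolding has_vector_derivative_def has_derivative_at by blast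
  moreover have "norm (f (0 + t) - f 0 - t *\<^sub>R D) / norm t = norm ((f t - f 0) /\<^sub>R t - D)" if "t \<noteq> 0" for t
  proof -
    have "(f t - f 0) /\<^sub>R t - D = (f (0 + t) - f 0 - t *\<^sub>R D) /\<^sub>R t"
      using that by (simp add: scaleR_diff_right)
    then show ?thesis by (simp add: divide_inverse mult.commute)
  qed
  then have "\<forall>\<^sub>F t in at 0. norm (f (0 + t) - f 0 - t *\<^sub>R D) / norm t = norm ((f t - f 0) /\<^sub>R t - D)"
    by (auto simp: eventually_at intro!: exI[of _ 1])
  ultimately have "((\<lambda>t. norm ((f t - f 0) /\<^sub>R t - D)) \<longlongrightarrow> 0) (at 0)"
    by (rule Lim_transform_eventually)
  then have "((\<lambda>t. (f t - f 0) /\<^sub>R t - D) \<longlongrightarrow> 0) (at 0)" by (rule tendsto_norm_zero_cancel)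
  then show ?thesis by (rule LIM_zero_cancel)
qed

section \<open>The inner normal of a smooth strictly convex body\<close>

locale smooth_strictly_convex_body =
  fixes K :: "'a::euclidean_space set"
  assumes strictly_convex: "strictly_convex_body K"
    and smooth: "C2_hypersurface (frontier K)"
begin

abbreviation "\<Sigma> \<equiv> frontier K"

lemma body: "compact K" "convex K" "interior K \<noteq> {}" "closed K" "bounded K"
  using strictly_convex compact_imp_closed compact_imp_bounded unfolding strictly_convex_body_def by auto

lemma open_segment_interior:
  assumes "p \<in> \<Sigma>" "q \<in> \<Sigma>" "p \<noteq> q"
  shows "open_segment p q \<subseteq> interior K"
  using strictly_convex assms unfolding strictly_convex_body_def by auto

lemma boundary_in_body: "p \<in> \<Sigma> \<Longrightarrow> p \<in> K"
  using body frontier_subset_closed by blast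

lemma boundary_not_interior: "p \<in> \<Sigma> \<Longrightarrow> p \<notin> interior K"
  by (simp add: frontier_def)

lemma compact_boundary: "compact \<Sigma>"
  using body by (simp add: compact_frontier)

lemma body_in_halfspace:
  assumes "\<forall>y\<in>interior K. b \<le> a \<bullet> y"
  shows "\<forall>y\<in>K. b \<le> a \<bullet> y"
proof -
  have "closure (interior K) \<subseteq> {y. b \<le> a \<bullet> y}"
    using assms by (intro closure_minimal) (auto simp: closed_halfspace_ge)
  then show ?thesis using convex_closure_interior[OF body(2,3)] body(4) by auto
qed

definition supporting_normal :: "'a \<Rightarrow> 'a \<Rightarrow> bool" where
  "supporting_normal p n \<longleftrightarrow> norm n = 1 \<and> (\<forall>q\<in>K. 0 \<le> n \<bullet> (q - p))"

lemma supporting_normal_exists: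
  assumes "p \<in> \<Sigma>"
  shows "\<exists>n. supporting_normal p n"
proof -
  obtain a b where a: "a \<noteq> 0" "\<forall>x\<in>{p}. a \<bullet> x \<le> b" "\<forall>x\<in>interior K. b \<le> a \<bullet> x"
    using separating_hyperplane_sets[of "{p}" "interior K"] body boundary_not_interior[OF assms]
    by (auto simp: convex_interior)
  have "\<forall>y\<in>K. b \<le> a \<bullet> y" using a(3) by (rule body_in_halfspace)
  then have "\<forall>q\<in>K. 0 \<le> a \<bullet> (q - p)" using a(2) by (force simp: inner_diff_right)
  then have "supporting_normal p (a /\<^sub>R norm a)"
    using a(1) by (simp add: supporting_normal_def)
  then show ?thesis ..
qed

text \<open>
  The estimate is strict because the body still contains a point a little further down in the
  direction \<open>- n\<close>.
\<close>

lemma supporting_normal_interior_pos: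
  assumes "supporting_normal p n" "q \<in> interior K"
  shows "0 < n \<bullet> (q - p)"
proof -
  obtain e where e: "e > 0" "cball q e \<subseteq> K" using assms(2) by (meson mem_interior_cball)
  have "q - e *\<^sub>R n \<in> cball q e" using assms(1) e by (simp add: dist_norm supporting_normal_def)
  then have "0 \<le> n \<bullet> (q - e *\<^sub>R n - p)" using assms(1) e unfolding supporting_normal_def by blast
  then have "e * (n \<bullet> n) \<le> n \<bullet> (q - p)" by (simp add: inner_diff_right)
  moreover have "n \<bullet> n = 1" using assms(1) by (simp add: supporting_normal_def norm_eq_1)
  ultimately show ?thesis using e by simp
qed

lemma supporting_normal_pos:
  assumes "supporting_normal p n" "p \<in> \<Sigma>" "q \<in> K" "q \<noteq> p"
  shows "0 < n \<bullet> (q - p)"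
proof (cases "q \<in> interior K")
  case True then show ?thesis using supporting_normal_interior_pos assms by blast
next
  case False
  then have "q \<in> \<Sigma>" using assms(3) by (simp add: frontier_def closure_subset[THEN subsetD])
  then have "midpoint p q \<in> interior K"
    using open_segment_interior assms by (metis midpoint_in_open_segment subsetD)
  then have "0 < n \<bullet> (midpoint p q - p)" using supporting_normal_interior_pos assms by blast
  also have "midpoint p q - p = (1/2) *\<^sub>R (q - p)"
    by (simp add: midpoint_def algebra_simps flip: scaleR_2)
  finally show ?thesis by simp
qed

text \<open>
  A defining function rewritten in terms of its gradient \<open>g\<close>, which is a \<open>C\<^sup>1\<close> vector field.
\<close>

lemma boundary_chart:
  assumes "p \<in> \<Sigma>"
  obtains U f g g' where "open U" "p \<in> U" "\<Sigma> \<inter> U = {q \<in> U. f q = 0}"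
    "\<And>q. q \<in> U \<Longrightarrow> (f has_derivative (\<lambda>v. g q \<bullet> v)) (at q)"
    "\<And>q. q \<in> U \<Longrightarrow> (g has_derivative blinfun_apply (g' q :: 'a \<Rightarrow>\<^sub>L 'a)) (at q)"
    "continuous_on U g'" "\<And>q. q \<in> U \<Longrightarrow> g q \<noteq> 0"
proof -
  obtain U and f :: "'a \<Rightarrow> real" where U: "open U" "p \<in> U" "C2_on U f"
     "\<forall>q\<in>U. \<not> (f has_derivative (\<lambda>_. 0)) (at q)" "\<Sigma> \<inter> U = {q \<in> U. f q = 0}"
    using smooth assms unfolding C2_hypersurface_def by metis
  obtain f' where f': "\<forall>q\<in>U. (f has_derivative blinfun_apply (f' q)) (at q)" "C1_on U f'"
    using U(3) unfolding C2_on_def by auto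
  obtain f'' where f'': "\<forall>q\<in>U. (f' has_derivative blinfun_apply (f'' q)) (at q)" "continuous_on U f''"
    using f'(2) unfolding C1_on_def by auto
  define grad :: "('a \<Rightarrow>\<^sub>L real) \<Rightarrow> 'a" where "grad \<phi> = (\<Sum>b\<in>Basis. blinfun_apply \<phi> b *\<^sub>R b)" for \<phi>
  have grad: "bounded_linear grad"
    unfolding grad_def by (intro bounded_linear_intros)
  have grad_inner: "grad \<phi> \<bullet> v = blinfun_apply \<phi> v" for \<phi> v
  proof -
    have "blinfun_apply \<phi> v = blinfun_apply \<phi> (\<Sum>b\<in>Basis. (v \<bullet> b) *\<^sub>R b)" by (simp add: euclidean_representation)
    also have "\<dots> = (\<Sum>b\<in>Basis. (v \<bullet> b) * blinfun_apply \<phi> b)"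
      by (simp add: blinfun.sum_right blinfun.scaleR_right)
    also have "\<dots> = (\<Sum>b\<in>Basis. blinfun_apply \<phi> b * (b \<bullet> v))"
      by (intro sum.cong refl) (subst inner_commute, rule mult.commute)
    also have "\<dots> = grad \<phi> \<bullet> v"
      by (simp add: grad_def inner_sum_left)
    finally show ?thesis ..
  qed
  define G where "G = Blinfun grad"
  have G: "blinfun_apply G = grad" by (simp add: G_def bounded_linear_Blinfun_apply grad)
  show ?thesis
  proof (rule that[of U f "\<lambda>q. grad (f' q)" "\<lambda>q. G o\<^sub>L f'' q"])
    show "\<And>q. q \<in> U \<Longrightarrow> (f has_derivative (\<lambda>v. grad (f' q) \<bullet> v)) (at q)"
      using f' by (simp add: grad_inner)
    show "((\<lambda>q. grad (f' q)) has_derivative blinfun_apply (G o\<^sub>L f'' q)) (at q)" if "q \<in> U" for q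
    proof -
      have "((\<lambda>q. grad (f' q)) has_derivative (\<lambda>v. grad (blinfun_apply (f'' q) v))) (at q)"
        using f'' that by (intro bounded_linear.has_derivative[OF grad]) auto
      then show ?thesis by (simp add: blinfun_compose.rep_eq G o_def)
    qed
    show "continuous_on U (\<lambda>q. G o\<^sub>L f'' q)" using f'' by (intro continuous_intros)
    show "grad (f' q) \<noteq> 0" if "q \<in> U" for q
    proof
      assume "grad (f' q) = 0"
      then have "blinfun_apply (f' q) = (\<lambda>_. 0)" by (metis grad_inner inner_zero_left)
      then show False using U(4) f'(1) that by metis
    qed
  qed (use U in auto)
qed

text \<open>
  Moving from \<open>p\<close> in a direction \<open>v\<close> tangent to the level set, slightly corrected by a multiple of
  the gradient in either sense, changes the sign of \<open>f\<close>. Between the two there is a boundary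
  point, which the supporting half-space contains. The correction can be taken arbitrarily small
  compared with \<open>v\<close>.
\<close>

lemma supporting_normal_orthogonal_kernel:
  assumes p: "p \<in> \<Sigma>" and U: "open U" "p \<in> U" "\<Sigma> \<inter> U = {q \<in> U. f q = 0}"
    and f: "\<And>q. q \<in> U \<Longrightarrow> (f has_derivative (\<lambda>v. g q \<bullet> v)) (at q)" and "g p \<noteq> (0::'a)"
    and n: "supporting_normal p n" and v: "g p \<bullet> v = 0"
  shows "0 \<le> n \<bullet> v"
proof -
  have "- (n \<bullet> v) \<le> 0 + \<eta>" if "\<eta> > 0" for \<eta>
  proof -
    (* the size of the correction: its contribution to the inner product with n is at most \<eta> *)
    define c where "c = \<eta> / (\<bar>n \<bullet> g p\<bar> + 1)"
    have c: "c > 0" using that by (simp add: c_def)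
    have fp: "f p = 0" using U p by auto
    define \<phi> where "\<phi> s t = f (p + t *\<^sub>R (v + s *\<^sub>R g p))" for s t
    have der: "(\<phi> s has_real_derivative (s * (g p \<bullet> g p))) (at 0)" for s
    proof -
      have 1: "(f has_derivative (\<lambda>u. g p \<bullet> u)) (at (p + 0 *\<^sub>R (v + s *\<^sub>R g p)))" using f U by simp
      have "(\<phi> s has_derivative (\<lambda>y. g p \<bullet> (y *\<^sub>R (v + s *\<^sub>R g p)))) (at 0)"
        unfolding \<phi>_def
        by (rule has_derivative_compose[where g=f and f="\<lambda>t. p + t *\<^sub>R (v + s *\<^sub>R g p)" and f'="\<lambda>y. y *\<^sub>R (v + s *\<^sub>R g p)", OF _ 1])
           (auto intro!: derivative_eq_intros)
      moreover have "(\<lambda>y. g p \<bullet> (y *\<^sub>R (v + s *\<^sub>R g p))) = (*) (s * (g p \<bullet> g p))"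
        using v by (simp add: fun_eq_iff inner_add_right)
      ultimately show ?thesis by (simp add: has_field_derivative_def)
    qed
    have gg: "g p \<bullet> g p > 0" using assms(6) by simp
    obtain d1 where d1: "d1 > 0" "\<forall>h>0. h < d1 \<longrightarrow> \<phi> c 0 < \<phi> c (0 + h)"
      using DERIV_pos_inc_right[OF der[of c]] c gg by auto
    obtain d2 where d2: "d2 > 0" "\<forall>h>0. h < d2 \<longrightarrow> \<phi> (-c) 0 > \<phi> (-c) (0 + h)"
      using DERIV_neg_dec_right[OF der[of "-c"]] c gg by auto
    obtain r where r: "r > 0" "ball p r \<subseteq> U" using U by (meson openE)
    define b where "b = norm v + c * norm (g p) + 1"
    have b: "b > 0" using c by (simp add: b_def add_nonneg_pos)
    define t where "t = min (min d1 d2) (r / b) / 2"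
    have t: "0 < t" "t < d1" "t < d2" "t < r / b"
    proof -
      define m where "m = min (min d1 d2) (r / b)"
      have "0 < m" "m \<le> d1" "m \<le> d2" "m \<le> r / b" using d1(1) d2(1) r b by (simp_all add: m_def)
      moreover have "t = m / 2" by (simp add: t_def m_def)
      ultimately show "0 < t" "t < d1" "t < d2" "t < r / b" by linarith+
    qed
    have inU: "p + t *\<^sub>R (v + s *\<^sub>R g p) \<in> U" if "-c \<le> s" "s \<le> c" for s
    proof -
      have "norm (v + s *\<^sub>R g p) \<le> norm v + \<bar>s\<bar> * norm (g p)" by (metis norm_scaleR norm_triangle_ineq)
      also have "\<dots> \<le> norm v + c * norm (g p)" using that by (intro add_left_mono mult_right_mono) auto
      also have "\<dots> \<le> b" by (simp add: b_def)
      finally have "norm (t *\<^sub>R (v + s *\<^sub>R g p)) \<le> t * b" using t by simp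
      also have "\<dots> < r" using t b by (simp add: pos_less_divide_eq)
      finally have "p + t *\<^sub>R (v + s *\<^sub>R g p) \<in> ball p r" by (simp add: dist_norm)
      then show ?thesis using r by blast
    qed
    have "continuous_on {-c..c} (\<lambda>s. \<phi> s t)"
    proof -
      have "continuous_on U f" using f by (meson continuous_at_imp_continuous_on has_derivative_continuous)
      then show ?thesis unfolding \<phi>_def
        by (rule continuous_on_compose2) (auto intro!: continuous_intros inU)
    qed
    moreover have "\<phi> (-c) t \<le> 0" "0 \<le> \<phi> c t"
      using d1(2) d2(2) t fp by (auto simp: \<phi>_def dest!: spec[of _ t])
    ultimately obtain s where s: "-c \<le> s" "s \<le> c" "\<phi> s t = 0"
      using IVT'[of "\<lambda>s. \<phi> s t" "-c" 0 c] c by auto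
    have "p + t *\<^sub>R (v + s *\<^sub>R g p) \<in> \<Sigma>" using s inU[of s] U(3) by (auto simp: \<phi>_def)
    then have "0 \<le> n \<bullet> (t *\<^sub>R (v + s *\<^sub>R g p))"
      using n boundary_in_body unfolding supporting_normal_def by fastforce
    then have "0 \<le> n \<bullet> v + s * (n \<bullet> g p)" using t by (simp add: inner_add_right zero_le_mult_iff)
    moreover have "s * (n \<bullet> g p) \<le> \<bar>s\<bar> * \<bar>n \<bullet> g p\<bar>" by (metis abs_ge_self abs_mult)
    moreover have "\<bar>s\<bar> * \<bar>n \<bullet> g p\<bar> \<le> c * (\<bar>n \<bullet> g p\<bar> + 1)" using s c by (intro mult_mono) auto
    moreover have "c * (\<bar>n \<bullet> g p\<bar> + 1) = \<eta>" unfolding c_def by (simp add: add_nonneg_eq_0_iff)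
    ultimately show ?thesis by linarith
  qed
  then have "- (n \<bullet> v) \<le> 0" by (rule field_le_epsilon)
  then show ?thesis by simp
qed

lemma supporting_normal_parallel_gradient:
  assumes p: "p \<in> \<Sigma>" and U: "open U" "p \<in> U" "\<Sigma> \<inter> U = {q \<in> U. f q = 0}"
    and f: "\<And>q. q \<in> U \<Longrightarrow> (f has_derivative (\<lambda>v. g q \<bullet> v)) (at q)" and g: "g p \<noteq> (0::'a)"
    and n: "supporting_normal p n"
  shows "\<exists>c. c \<noteq> 0 \<and> n = c *\<^sub>R g p"
proof -
  define c where "c = (n \<bullet> g p) / (g p \<bullet> g p)"
  define r where "r = n - c *\<^sub>R g p"
  have gr: "g p \<bullet> r = 0" using g by (simp add: r_def c_def inner_diff_right inner_commute)
  have "0 \<le> n \<bullet> r" "0 \<le> n \<bullet> (- r)"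
    by (rule supporting_normal_orthogonal_kernel[OF assms]; simp add: gr)+
  then have "n \<bullet> r = 0" by simp
  then have "r \<bullet> r = 0" using gr by (simp add: r_def inner_diff_left)
  then have "n = c *\<^sub>R g p" by (simp add: r_def)
  moreover have "n \<noteq> 0" using n by (auto simp: supporting_normal_def)
  ultimately show ?thesis by auto
qed

text \<open>
  At a corner a convex body has many supporting normals. Smoothness excludes this, since each of
  them is a multiple of the gradient.
\<close>

lemma supporting_normal_unique:
  assumes p: "p \<in> \<Sigma>" and n: "supporting_normal p n" "supporting_normal p m"
  shows "n = m"
proof -
  obtain U f g g' where U: "open U" "p \<in> U" "\<Sigma> \<inter> U = {q \<in> U. f q = 0}"
    "\<And>q. q \<in> U \<Longrightarrow> (f has_derivative (\<lambda>v. g q \<bullet> v)) (at q)"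
    "\<And>q. q \<in> U \<Longrightarrow> (g has_derivative blinfun_apply (g' q :: 'a \<Rightarrow>\<^sub>L 'a)) (at q)"
    "continuous_on U g'" "\<And>q. q \<in> U \<Longrightarrow> g q \<noteq> 0" by (rule boundary_chart[OF p]) blast
  obtain a where a: "n = a *\<^sub>R g p"
    using supporting_normal_parallel_gradient[OF p U(1-4) U(7)[OF U(2)] n(1)] by auto
  obtain b where b: "m = b *\<^sub>R g p"
    using supporting_normal_parallel_gradient[OF p U(1-4) U(7)[OF U(2)] n(2)] by auto
  have "\<bar>a\<bar> * norm (g p) = \<bar>b\<bar> * norm (g p)" using n a b by (simp add: supporting_normal_def)
  then have ab: "\<bar>a\<bar> = \<bar>b\<bar>" using U(2,7) by simp
  obtain z where z: "z \<in> interior K" using body by auto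
  have "0 < a * (g p \<bullet> (z - p))" "0 < b * (g p \<bullet> (z - p))"
    using supporting_normal_interior_pos[OF n(1) z] supporting_normal_interior_pos[OF n(2) z] a b by auto
  then have "a = b" using ab by (auto simp: zero_less_mult_iff)
  then show ?thesis using a b by simp
qed

definition normal :: "'a \<Rightarrow> 'a" where
  "normal p = (THE n. supporting_normal p n)"

lemma supporting_normal_normal: "p \<in> \<Sigma> \<Longrightarrow> supporting_normal p (normal p)"
  unfolding normal_def by (metis supporting_normal_exists supporting_normal_unique theI)

lemma normal_eqI: "p \<in> \<Sigma> \<Longrightarrow> supporting_normal p n \<Longrightarrow> normal p = n"
  by (metis supporting_normal_normal supporting_normal_unique)

lemma norm_normal: "p \<in> \<Sigma> \<Longrightarrow> norm (normal p) = 1"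
  using supporting_normal_normal supporting_normal_def by blast

lemma normal_inner_normal: "p \<in> \<Sigma> \<Longrightarrow> normal p \<bullet> normal p = 1"
  using norm_normal norm_eq_1 by blast

lemma normal_pos: "p \<in> \<Sigma> \<Longrightarrow> q \<in> K \<Longrightarrow> q \<noteq> p \<Longrightarrow> 0 < normal p \<bullet> (q - p)"
  using supporting_normal_normal supporting_normal_pos by blast

text \<open>
  The field is the normalised gradient, with the sign that makes it point to a fixed interior
  point. Its derivative is a multiple of the symmetric derivative of the gradient, plus a multiple
  of the gradient itself; the latter is not seen by tangent vectors.
\<close>

lemma normal_extension:
  assumes p: "p \<in> \<Sigma>"
  obtains U N N' where "open U" "p \<in> U" 
    "\<And>q. q \<in> U \<Longrightarrow> (N has_derivative blinfun_apply (N' q :: 'a \<Rightarrow>\<^sub>L 'a)) (at q)"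
    "continuous_on U N'" "\<And>q. q \<in> U \<Longrightarrow> q \<in> \<Sigma> \<Longrightarrow> N q = normal q"
    "\<And>q v w. q \<in> U \<Longrightarrow> q \<in> \<Sigma> \<Longrightarrow> normal q \<bullet> v = 0 \<Longrightarrow> normal q \<bullet> w = 0 \<Longrightarrow>
      blinfun_apply (N' q) v \<bullet> w = blinfun_apply (N' q) w \<bullet> v"
proof -
  obtain U f g g' where U: "open U" "p \<in> U" "\<Sigma> \<inter> U = {q \<in> U. f q = 0}"
    and f: "\<And>q. q \<in> U \<Longrightarrow> (f has_derivative (\<lambda>v. g q \<bullet> v)) (at q)"
    and g: "\<And>q. q \<in> U \<Longrightarrow> (g has_derivative blinfun_apply (g' q :: 'a \<Rightarrow>\<^sub>L 'a)) (at q)"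
    "continuous_on U g'" "\<And>q. q \<in> U \<Longrightarrow> g q \<noteq> 0" by (rule boundary_chart[OF p]) blast
  have cg: "continuous_on U g" using g(1) by (meson continuous_at_imp_continuous_on has_derivative_continuous)
  obtain z where z: "z \<in> interior K" using body by auto
  have par: "\<exists>c. c \<noteq> 0 \<and> normal q = c *\<^sub>R g q" if "q \<in> U" "q \<in> \<Sigma>" for q
    using supporting_normal_parallel_gradient[OF that(2) U(1) that(1) U(3) f g(3)[OF that(1)] supporting_normal_normal[OF that(2)]] .
  define \<sigma> where "\<sigma> = sgn (g p \<bullet> (z - p))"
  define h where "h q = \<sigma> * (g q \<bullet> (z - q))" for q
  have ch: "continuous_on U h" unfolding h_def by (intro continuous_intros cg)
  have "g p \<bullet> (z - p) \<noteq> 0"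
    using par[OF U(2) p] supporting_normal_interior_pos[OF supporting_normal_normal[OF p] z] by auto
  then have hp: "h p > 0" and \<sigma>: "\<bar>\<sigma>\<bar> = 1" by (auto simp: h_def \<sigma>_def sgn_if)
  (* on W the vector \<sigma> g points to the side of the interior point z *)
  define W where "W = {q \<in> U. h q \<in> {0<..}}"
  have W: "open W" "p \<in> W" "W \<subseteq> U"
    using U hp continuous_open_preimage[OF ch U(1), of "{0<..}"] by (auto simp: W_def vimage_def Int_def)
  define N where "N q = \<sigma> *\<^sub>R (inverse (norm (g q)) *\<^sub>R g q)" for q
  define N' where "N' q = \<sigma> *\<^sub>R (inverse (norm (g q)) *\<^sub>R g' q
     - (inverse (norm (g q)) ^ 3) *\<^sub>R (blinfun_scaleR_left (g q) o\<^sub>L (blinfun_inner_left (g q) o\<^sub>L g' q)))" for q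
  have N'_apply: "blinfun_apply (N' q) v = \<sigma> *\<^sub>R (inverse (norm (g q)) *\<^sub>R g' q v
     - ((inverse (norm (g q)) ^ 3) * (g' q v \<bullet> g q)) *\<^sub>R g q)" for q v
    by (simp add: N'_def blinfun.bilinear_simps)
  show ?thesis
  proof (rule that[of W N N'])
    show "(N has_derivative blinfun_apply (N' q)) (at q)" if "q \<in> W" for q
    proof -
      have q: "q \<in> U" "g q \<noteq> 0" using that W g by auto
      have 1: "((\<lambda>q. norm (g q)) has_derivative (\<lambda>v. g' q v \<bullet> sgn (g q))) (at q)"
        using has_derivative_compose[OF g(1)[OF q(1)] has_derivative_norm[OF q(2)]] by (simp add: inner_commute)
      have "((\<lambda>q. inverse (norm (g q))) has_derivative (\<lambda>v. - (inverse (norm (g q)) * (g' q v \<bullet> sgn (g q)) * inverse (norm (g q))))) (at q)"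
        using q by (intro Deriv.has_derivative_inverse 1) auto
      then have "(N has_derivative (\<lambda>v. \<sigma> *\<^sub>R (inverse (norm (g q)) *\<^sub>R g' q v
         + (- (inverse (norm (g q)) * (g' q v \<bullet> sgn (g q)) * inverse (norm (g q)))) *\<^sub>R g q))) (at q)"
        unfolding N_def by (intro has_derivative_scaleR_right has_derivative_scaleR g q)
      moreover have "(\<lambda>v. \<sigma> *\<^sub>R (inverse (norm (g q)) *\<^sub>R g' q v
         + (- (inverse (norm (g q)) * (g' q v \<bullet> sgn (g q)) * inverse (norm (g q)))) *\<^sub>R g q)) = blinfun_apply (N' q)"
        by (rule ext) (simp add: N'_apply sgn_div_norm power3_eq_cube divide_inverse)
      ultimately show ?thesis by simp
    qed
    have "continuous_on W g" "continuous_on W g'" using cg g(2) W(3) continuous_on_subset by blast+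
    moreover have "\<forall>q\<in>W. norm (g q) \<noteq> 0" using g(3) W(3) by auto
    ultimately show "continuous_on W N'"
      unfolding N'_def by (auto intro!: continuous_intros bounded_linear.continuous_on[OF bounded_linear_blinfun_scaleR_left]
         bounded_linear.continuous_on[OF bounded_linear_blinfun_inner_left])
    show "N q = normal q" if q: "q \<in> W" "q \<in> \<Sigma>" for q
    proof -
      have "q \<in> U" using q W by auto
      then obtain c where c: "c \<noteq> 0" "normal q = c *\<^sub>R g q" using par q by auto
      have "\<bar>c\<bar> * norm (g q) = 1" using norm_normal[OF q(2)] c by simp
      moreover have "0 < c * (g q \<bullet> (z - q))"
        using supporting_normal_interior_pos[OF supporting_normal_normal[OF q(2)] z] c by simp
      moreover have "0 < \<sigma> * (g q \<bullet> (z - q))" using q by (simp add: W_def h_def)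
      moreover have "norm (g q) \<noteq> 0" using g(3)[OF \<open>q \<in> U\<close>] by simp
      ultimately have "c = \<sigma> * inverse (norm (g q))"
        using \<sigma> by (auto simp: zero_less_mult_iff abs_if nonzero_eq_divide_eq divide_inverse[symmetric] split: if_splits)
      then show ?thesis using c by (simp add: N_def)
    qed
    show "blinfun_apply (N' q) v \<bullet> w = blinfun_apply (N' q) w \<bullet> v"
      if q: "q \<in> W" "q \<in> \<Sigma>" "normal q \<bullet> v = 0" "normal q \<bullet> w = 0" for q v w
    proof -
      have "q \<in> U" using q W by auto
      then obtain c where c: "c \<noteq> 0" "normal q = c *\<^sub>R g q" using par q by auto
      then have "g q \<bullet> v = 0" "g q \<bullet> w = 0" using q by auto
      moreover have "g' q v \<bullet> w = g' q w \<bullet> v"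
        using derivative_of_gradient_symmetric[OF U(1) \<open>q \<in> U\<close> f g(1)[OF \<open>q \<in> U\<close>]] .
      ultimately show ?thesis by (simp add: N'_apply inner_diff_left)
    qed
  qed (use W in auto)
qed

lemma continuous_on_normal: "continuous_on \<Sigma> normal"
proof -
  have "continuous (at p within \<Sigma>) normal" if p: "p \<in> \<Sigma>" for p
  proof -
    obtain U N N' where U: "open U" "p \<in> U" 
      "\<And>q. q \<in> U \<Longrightarrow> (N has_derivative blinfun_apply (N' q :: 'a \<Rightarrow>\<^sub>L 'a)) (at q)"
      "continuous_on U N'" "\<And>q. q \<in> U \<Longrightarrow> q \<in> \<Sigma> \<Longrightarrow> N q = normal q" using normal_extension[OF p] by metis
    have "continuous (at p within \<Sigma>) N"
      using U by (meson continuous_at_imp_continuous_at_within has_derivative_continuous)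
    then have "(N \<longlongrightarrow> normal p) (at p within \<Sigma>)" using U p by (simp add: continuous_within)
    then have "(normal \<longlongrightarrow> normal p) (at p within \<Sigma>)"
      by (rule Lim_transform_eventually) (use U in \<open>auto simp: eventually_at_topological\<close>)
    then show ?thesis by (simp add: continuous_within)
  qed
  then show ?thesis by (simp add: continuous_on_eq_continuous_within)
qed

section \<open>Transversal intersection of lines with the boundary\<close>

text \<open>
  Implicit function theorem for \<open>f (p + t w) = 0\<close>, obtained by inverting the map
  \<open>(p, w, t) \<mapsto> (p, w, f (p + t w))\<close>. Transversality is what makes its derivative invertible. The
  derivative of \<open>\<tau>\<close> is expressed with the unit normal in place of the gradient, so that it does
  not refer to a chart.
\<close>

lemma boundary_hit:
  assumes z: "p\<^sub>0 + t\<^sub>0 *\<^sub>R w\<^sub>0 \<in> \<Sigma>" and tr: "normal (p\<^sub>0 + t\<^sub>0 *\<^sub>R w\<^sub>0) \<bullet> w\<^sub>0 \<noteq> 0"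
  obtains V \<tau> where "open V" "(p\<^sub>0, w\<^sub>0) \<in> V" "\<tau> (p\<^sub>0, w\<^sub>0) = t\<^sub>0"
    "\<And>x. x \<in> V \<Longrightarrow> fst x + \<tau> x *\<^sub>R snd x \<in> \<Sigma>"
    "\<And>x. x \<in> V \<Longrightarrow> normal (fst x + \<tau> x *\<^sub>R snd x) \<bullet> snd x \<noteq> 0"
    "\<And>x. x \<in> V \<Longrightarrow> (\<tau> has_derivative (\<lambda>d. - (normal (fst x + \<tau> x *\<^sub>R snd x) \<bullet> (fst d + \<tau> x *\<^sub>R snd d))
        / (normal (fst x + \<tau> x *\<^sub>R snd x) \<bullet> snd x))) (at x)"
proof -
  define z\<^sub>0 where "z\<^sub>0 = p\<^sub>0 + t\<^sub>0 *\<^sub>R w\<^sub>0"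
  have z0: "z\<^sub>0 \<in> \<Sigma>" using z by (simp add: z\<^sub>0_def)
  obtain U f g g' where U: "open U" "z\<^sub>0 \<in> U" "\<Sigma> \<inter> U = {q \<in> U. f q = 0}"
    and f: "\<And>q. q \<in> U \<Longrightarrow> (f has_derivative (\<lambda>v. g q \<bullet> v)) (at q)"
    and g: "\<And>q. q \<in> U \<Longrightarrow> (g has_derivative blinfun_apply (g' q :: 'a \<Rightarrow>\<^sub>L 'a)) (at q)"
    "continuous_on U g'" "\<And>q. q \<in> U \<Longrightarrow> g q \<noteq> 0" by (rule boundary_chart[OF z0]) blast
  have cg: "continuous_on U g" using g(1) by (meson continuous_at_imp_continuous_on has_derivative_continuous)
  have par: "\<exists>c. c \<noteq> 0 \<and> normal q = c *\<^sub>R g q" if "q \<in> U" "q \<in> \<Sigma>" for q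
    using supporting_normal_parallel_gradient[OF that(2) U(1) that(1) U(3) f g(3)[OF that(1)] supporting_normal_normal[OF that(2)]] .
  define Z where "Z y = fst (fst y) + snd y *\<^sub>R snd (fst y)" for y :: "('a \<times> 'a) \<times> real"
  have Z_deriv: "(Z has_derivative (\<lambda>d. fst (fst d) + (snd y *\<^sub>R snd (fst d) + snd d *\<^sub>R snd (fst y)))) (at y)" for y
    unfolding Z_def by (intro derivative_intros)
  have cZ: "continuous_on X Z" for X unfolding Z_def by (intro continuous_intros)
  define W where "W = {y \<in> Z -` U. g (Z y) \<bullet> snd (fst y) \<in> - {0}}"
  have "open (Z -` U)" using cZ U(1) open_vimage by blast
  moreover have "continuous_on (Z -` U) (\<lambda>y. g (Z y) \<bullet> snd (fst y))"
    by (intro continuous_intros continuous_on_compose2[OF cg] cZ) auto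
  ultimately have W: "open W"
    using continuous_open_preimage[of "Z -` U" "\<lambda>y. g (Z y) \<bullet> snd (fst y)" "- {0}"]
    by (auto simp: W_def vimage_def Int_def)
  define y\<^sub>0 where "y\<^sub>0 = ((p\<^sub>0, w\<^sub>0), t\<^sub>0)"
  have y0: "y\<^sub>0 \<in> W" "Z y\<^sub>0 = z\<^sub>0"
    using U(2) par[OF U(2) z0] tr by (auto simp: W_def y\<^sub>0_def Z_def z\<^sub>0_def)
  define G where "G y = (fst y, f (Z y))" for y
  define L where "L y d = (fst d, g (Z y) \<bullet> (fst (fst d) + (snd y *\<^sub>R snd (fst d) + snd d *\<^sub>R snd (fst y))))"
    for y d :: "('a \<times> 'a) \<times> real"
  have G_deriv: "(G has_derivative L y) (at y)" if "y \<in> W" for y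
  proof -
    have "(f has_derivative (\<lambda>v. g (Z y) \<bullet> v)) (at (Z y))" using f that by (auto simp: W_def)
    then show ?thesis unfolding G_def L_def
      by (intro has_derivative_Pair has_derivative_fst has_derivative_ident has_derivative_compose[OF Z_deriv])
  qed
  define G' where "G' y = Blinfun (L y)" for y
  have G'_apply: "blinfun_apply (G' y) = L y" for y
  proof -
    have "bounded_linear (L y)" unfolding L_def
      by (intro bounded_linear_intros)
    then show ?thesis by (simp add: G'_def bounded_linear_Blinfun_apply)
  qed
  have G'_cont: "continuous_on W G'"
  proof (rule continuous_on_blinfun_componentwise)
    fix i
    show "continuous_on W (\<lambda>y. blinfun_apply (G' y) i)"
      unfolding G'_apply L_def
      by (intro continuous_intros continuous_on_compose2[OF cg] cZ) (auto simp: W_def)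
  qed
  (* the inverse of the derivative at the base point: solve for the increment of t *)
  define M where "M = (\<lambda>e :: ('a \<times> 'a) \<times> real. (fst e, (snd e - g z\<^sub>0 \<bullet> (fst (fst e) + t\<^sub>0 *\<^sub>R snd (fst e))) / (g z\<^sub>0 \<bullet> w\<^sub>0)))"
  have M_inverse: "Blinfun M o\<^sub>L G' y\<^sub>0 = id_blinfun"
  proof (rule blinfun_eqI)
    fix d
    have "bounded_linear M" unfolding M_def divide_inverse by (intro bounded_linear_intros)
    moreover have "g z\<^sub>0 \<bullet> w\<^sub>0 \<noteq> 0" using y0 by (simp add: W_def) (simp add: y\<^sub>0_def)
    then have "M (L y\<^sub>0 d) = d"
      by (simp add: M_def L_def y0(2) prod_eq_iff) (simp add: y\<^sub>0_def inner_add_right)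
    ultimately show "blinfun_apply (Blinfun M o\<^sub>L G' y\<^sub>0) d = blinfun_apply id_blinfun d"
      by (simp add: bounded_linear_Blinfun_apply G'_apply)
  qed
  have "\<And>y. y \<in> W \<Longrightarrow> (G has_derivative blinfun_apply (G' y)) (at y)" using G_deriv by (simp add: G'_apply)
  then obtain U' V h h' where h: "open U'" "U' \<subseteq> W" "y\<^sub>0 \<in> U'" "open V" "G y\<^sub>0 \<in> V" "homeomorphism U' V G h"
    "\<And>y. y \<in> V \<Longrightarrow> (h has_derivative (h' y)) (at y)"
    using inverse_function_theorem[OF W _ G'_cont y0(1) M_inverse] by metis
  define V' where "V' = (\<lambda>x. (x, 0::real)) -` V"
  have V': "open V'" unfolding V'_def by (intro open_vimage h continuous_intros)
  define \<tau> where "\<tau> x = snd (h (x, 0))" for x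
  have G0: "G y\<^sub>0 = ((p\<^sub>0, w\<^sub>0), 0)" using U(2,3) z0 y0(2) by (auto simp: G_def) (simp add: y\<^sub>0_def)
  have hx: "h (x, 0) = (x, \<tau> x) \<and> h (x, 0) \<in> W \<and> f (Z (x, \<tau> x)) = 0" if "x \<in> V'" for x
  proof -
    have "h (x, 0) \<in> U'" "G (h (x, 0)) = (x, 0)"
      using h(6) that unfolding homeomorphism_def V'_def by auto
    then show ?thesis using h(2) by (auto simp: G_def \<tau>_def prod_eq_iff) (metis prod.collapse)
  qed
  have inW: "(x, \<tau> x) \<in> W" if "x \<in> V'" for x using hx[OF that] by metis
  have onS: "Z (x, \<tau> x) \<in> \<Sigma>" if "x \<in> V'" for x
    using hx[OF that] inW[OF that] U(3) by (auto simp: W_def)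
  have \<tau>_diff: "\<exists>T. (\<tau> has_derivative T) (at x)" if "x \<in> V'" for x
  proof -
    have "((\<lambda>x. h (x, 0)) has_derivative (\<lambda>d. h' (x, 0) (d, 0))) (at x)"
      by (rule has_derivative_compose[where f="\<lambda>x. (x, 0)" and f'="\<lambda>d. (d, 0)" and g = h])
         (use that h(7) in \<open>auto intro!: derivative_eq_intros simp: V'_def\<close>)
    then have "(\<tau> has_derivative (\<lambda>d. snd (h' (x, 0) (d, 0)))) (at x)"
      unfolding \<tau>_def by (rule has_derivative_snd)
    then show ?thesis by - (rule exI)
  qed
  show ?thesis
  proof (rule that[of V' \<tau>])
    show "(p\<^sub>0, w\<^sub>0) \<in> V'" using h(5) G0 by (simp add: V'_def)
    show "\<tau> (p\<^sub>0, w\<^sub>0) = t\<^sub>0"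
      using h(3,6) unfolding homeomorphism_def \<tau>_def G0[symmetric] by (simp add: y\<^sub>0_def)
    fix x assume x: "x \<in> V'"
    show "fst x + \<tau> x *\<^sub>R snd x \<in> \<Sigma>" using onS[OF x] by (simp add: Z_def)
    have "g (Z (x, \<tau> x)) \<bullet> snd x \<noteq> 0" "Z (x, \<tau> x) \<in> U" using inW[OF x] by (auto simp: W_def)
    moreover obtain c where c: "c \<noteq> 0" "normal (Z (x, \<tau> x)) = c *\<^sub>R g (Z (x, \<tau> x))"
      using par[OF _ onS[OF x]] calculation by auto
    ultimately have nz: "g (Z (x, \<tau> x)) \<bullet> snd x \<noteq> 0" "normal (Z (x, \<tau> x)) \<bullet> snd x \<noteq> 0" "Z (x, \<tau> x) \<in> U" by auto
    show "normal (fst x + \<tau> x *\<^sub>R snd x) \<bullet> snd x \<noteq> 0" using nz by (simp add: Z_def)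
    (* differentiate the identity f (p + \<tau> w) = 0 to identify the derivative of \<tau> *)
    obtain T where T: "(\<tau> has_derivative T) (at x)" using \<tau>_diff x by blast
    have "((\<lambda>x. Z (x, \<tau> x)) has_derivative (\<lambda>d. fst d + (\<tau> x *\<^sub>R snd d + T d *\<^sub>R snd x))) (at x)"
      unfolding Z_def fst_conv snd_conv by (intro derivative_intros T)
    then have "((\<lambda>x. f (Z (x, \<tau> x))) has_derivative (\<lambda>d. g (Z (x, \<tau> x)) \<bullet> (fst d + (\<tau> x *\<^sub>R snd d + T d *\<^sub>R snd x)))) (at x)"
      by (rule has_derivative_compose) (rule f[OF nz(3)])
    moreover have "((\<lambda>x. f (Z (x, \<tau> x))) has_derivative (\<lambda>d. 0)) (at x)"
      by (rule has_derivative_transform_within_open[OF has_derivative_const V' x]) (use hx in auto)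
    ultimately have "(\<lambda>d. g (Z (x, \<tau> x)) \<bullet> (fst d + (\<tau> x *\<^sub>R snd d + T d *\<^sub>R snd x))) = (\<lambda>d. 0)"
      by (rule has_derivative_unique)
    then have eq0: "g (Z (x, \<tau> x)) \<bullet> (fst d + (\<tau> x *\<^sub>R snd d + T d *\<^sub>R snd x)) = 0" for d
      by (rule fun_cong)
    have "normal (Z (x, \<tau> x)) \<bullet> (fst d + \<tau> x *\<^sub>R snd d) + T d * (normal (Z (x, \<tau> x)) \<bullet> snd x)
        = c * (g (Z (x, \<tau> x)) \<bullet> (fst d + (\<tau> x *\<^sub>R snd d + T d *\<^sub>R snd x)))" for d
      unfolding c(2) inner_scaleR_left inner_add_right inner_scaleR_right by (simp add: distrib_left mult.left_commute)
    then have "normal (Z (x, \<tau> x)) \<bullet> (fst d + \<tau> x *\<^sub>R snd d) + T d * (normal (Z (x, \<tau> x)) \<bullet> snd x) = 0" for d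
      by (simp only: eq0 mult_zero_right)
    then have "T d = - (normal (Z (x, \<tau> x)) \<bullet> (fst d + \<tau> x *\<^sub>R snd d)) / (normal (Z (x, \<tau> x)) \<bullet> snd x)" for d
      using nz(2) by (subst nonzero_eq_divide_eq) (simp_all add: eq_neg_iff_add_eq_0 add.commute)
    then have T_eq: "T = (\<lambda>d. - (normal (fst x + \<tau> x *\<^sub>R snd x) \<bullet> (fst d + \<tau> x *\<^sub>R snd d)) / (normal (fst x + \<tau> x *\<^sub>R snd x) \<bullet> snd x))"
      by (simp add: Z_def fun_eq_iff)
    show "(\<tau> has_derivative (\<lambda>d. - (normal (fst x + \<tau> x *\<^sub>R snd x) \<bullet> (fst d + \<tau> x *\<^sub>R snd d)) / (normal (fst x + \<tau> x *\<^sub>R snd x) \<bullet> snd x))) (at x)"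
      using T by (simp only: T_eq)
  qed (use V' in auto)
qed

lemma boundary_hit_curve:
  assumes "open I" "s \<in> I"
    and p: "\<And>t. t \<in> I \<Longrightarrow> (p has_vector_derivative p' t) (at t)" "continuous_on I p'"
    and w: "\<And>t. t \<in> I \<Longrightarrow> (w has_vector_derivative w' t) (at t)" "continuous_on I w'"
    and z: "p s + a *\<^sub>R w s \<in> \<Sigma>" "normal (p s + a *\<^sub>R w s) \<bullet> w s \<noteq> 0"
  obtains J \<sigma> \<sigma>' where "open J" "J \<subseteq> I" "s \<in> J" "\<sigma> s = a"
    "\<And>t. t \<in> J \<Longrightarrow> p t + \<sigma> t *\<^sub>R w t \<in> \<Sigma>"
    "\<And>t. t \<in> J \<Longrightarrow> (\<sigma> has_vector_derivative \<sigma>' t) (at t)"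
    "continuous_on J \<sigma>'"
    "\<sigma>' s = - (normal (p s + a *\<^sub>R w s) \<bullet> (p' s + a *\<^sub>R w' s)) / (normal (p s + a *\<^sub>R w s) \<bullet> w s)"
proof -
  obtain V \<tau> where V: "open V" "(p s, w s) \<in> V" "\<tau> (p s, w s) = a"
    "\<And>x. x \<in> V \<Longrightarrow> fst x + \<tau> x *\<^sub>R snd x \<in> \<Sigma>"
    "\<And>x. x \<in> V \<Longrightarrow> normal (fst x + \<tau> x *\<^sub>R snd x) \<bullet> snd x \<noteq> 0"
    "\<And>x. x \<in> V \<Longrightarrow> (\<tau> has_derivative (\<lambda>d. - (normal (fst x + \<tau> x *\<^sub>R snd x) \<bullet> (fst d + \<tau> x *\<^sub>R snd d))
        / (normal (fst x + \<tau> x *\<^sub>R snd x) \<bullet> snd x))) (at x)" by (rule boundary_hit[OF z]) blast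
  have cpw: "continuous_on I p" "continuous_on I w"
    by (rule has_vector_derivative_imp_continuous_on, erule p(1) w(1))+
  define J where "J = {t \<in> I. (p t, w t) \<in> V}"
  have "open J" using continuous_open_preimage[of I "\<lambda>t. (p t, w t)" V] cpw assms(1) V(1)
    by (auto simp: J_def vimage_def Int_def intro!: continuous_intros)
  define \<sigma> where "\<sigma> t = \<tau> (p t, w t)" for t
  define \<sigma>' where "\<sigma>' t = - (normal (p t + \<sigma> t *\<^sub>R w t) \<bullet> (p' t + \<sigma> t *\<^sub>R w' t)) / (normal (p t + \<sigma> t *\<^sub>R w t) \<bullet> w t)" for t
  have onS: "p t + \<sigma> t *\<^sub>R w t \<in> \<Sigma>" if "t \<in> J" for t
    using V(4)[of "(p t, w t)"] that by (simp add: J_def \<sigma>_def)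
  have der: "(\<sigma> has_vector_derivative \<sigma>' t) (at t)" if t: "t \<in> J" for t
  proof -
    have 1: "((\<lambda>t. (p t, w t)) has_vector_derivative (p' t, w' t)) (at t)"
      using p(1) w(1) t by (intro has_vector_derivative_Pair) (auto simp: J_def)
    have "(\<tau> has_derivative (\<lambda>d. - (normal (p t + \<sigma> t *\<^sub>R w t) \<bullet> (fst d + \<sigma> t *\<^sub>R snd d))
        / (normal (p t + \<sigma> t *\<^sub>R w t) \<bullet> w t))) (at (p t, w t))"
      using V(6)[of "(p t, w t)"] t by (simp add: \<sigma>_def J_def)
    from vector_derivative_diff_chain_within[OF 1 has_derivative_at_withinI[OF this]]
    show ?thesis by (simp add: o_def \<sigma>_def[symmetric] \<sigma>'_def)
  qed
  have "continuous_on J \<sigma>" using der by (rule has_vector_derivative_imp_continuous_on)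
  moreover have "continuous_on J p" "continuous_on J w" "continuous_on J p'" "continuous_on J w'"
    using cpw p(2) w(2) continuous_on_subset[of I _ J] by (auto simp: J_def)
  ultimately have "continuous_on J \<sigma>'" unfolding \<sigma>'_def
    by (intro continuous_intros continuous_on_compose2[OF continuous_on_normal])
       (use onS V(5) in \<open>force simp: J_def \<sigma>_def\<close>)+
  then show ?thesis
    using that[of J \<sigma> \<sigma>'] \<open>open J\<close> onS der V(2,3) assms(2) by (auto simp: J_def \<sigma>_def \<sigma>'_def)
qed

text \<open>
  The tangent line is pushed back to the boundary along the normal at \<open>q\<close>. The length of the push
  has derivative zero at the start, so the velocity is unchanged.
\<close>

lemma curve_with_velocity:
  assumes q: "q \<in> \<Sigma>" and v: "normal q \<bullet> v = 0"
  obtains \<delta> \<gamma> \<gamma>' where "\<delta> > 0" "\<And>t. \<bar>t\<bar> < \<delta> \<Longrightarrow> \<gamma> t \<in> \<Sigma>" "\<gamma> 0 = q" "\<gamma>' 0 = v"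
    "\<And>t. \<bar>t\<bar> < \<delta> \<Longrightarrow> (\<gamma> has_vector_derivative \<gamma>' t) (at t)" "continuous_on {-\<delta><..<\<delta>} \<gamma>'"
proof -
  define p where "p t = q + t *\<^sub>R v" for t
  have p: "(p has_vector_derivative v) (at t)" for t
    unfolding p_def by (auto intro!: derivative_eq_intros)
  have w: "((\<lambda>_. normal q) has_vector_derivative 0) (at t)" for t by (rule has_vector_derivative_const)
  obtain J \<sigma> \<sigma>' where J: "open J" "0 \<in> J" "\<sigma> 0 = 0"
    "\<And>t. t \<in> J \<Longrightarrow> p t + \<sigma> t *\<^sub>R normal q \<in> \<Sigma>"
    "\<And>t. t \<in> J \<Longrightarrow> (\<sigma> has_vector_derivative \<sigma>' t) (at t)"
    "continuous_on J \<sigma>'"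
    "\<sigma>' 0 = - (normal (p 0 + 0 *\<^sub>R normal q) \<bullet> (v + 0 *\<^sub>R 0)) / (normal (p 0 + 0 *\<^sub>R normal q) \<bullet> normal q)"
  proof (rule boundary_hit_curve[of UNIV 0 p "\<lambda>_. v" "\<lambda>_. normal q" "\<lambda>_. 0" 0])
    show "p 0 + 0 *\<^sub>R normal q \<in> \<Sigma>" "normal (p 0 + 0 *\<^sub>R normal q) \<bullet> normal q \<noteq> 0"
      using q normal_inner_normal[OF q] by (simp_all add: p_def)
  qed (use p w in auto)
  have s0: "\<sigma>' 0 = 0" using J(7) v by (simp add: p_def)
  obtain \<delta> where \<delta>: "\<delta> > 0" "ball 0 \<delta> \<subseteq> J" using J by (meson openE)
  have inJ: "t \<in> J" if "\<bar>t\<bar> < \<delta>" for t using \<delta> that by (auto simp: subset_iff)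
  show ?thesis
  proof (rule that[of \<delta> "\<lambda>t. p t + \<sigma> t *\<^sub>R normal q" "\<lambda>t. v + \<sigma>' t *\<^sub>R normal q"])
    show "((\<lambda>t. p t + \<sigma> t *\<^sub>R normal q) has_vector_derivative v + \<sigma>' t *\<^sub>R normal q) (at t)" if "\<bar>t\<bar> < \<delta>" for t
    proof -
      have "((\<lambda>t. \<sigma> t *\<^sub>R normal q) has_vector_derivative \<sigma>' t *\<^sub>R normal q) (at t)"
        using bounded_linear.has_vector_derivative[OF bounded_linear_scaleR_left J(5)[OF inJ[OF that]]] .
      then show ?thesis by (intro has_vector_derivative_add p)
    qed
    have "continuous_on {-\<delta><..<\<delta>} \<sigma>'" by (rule continuous_on_subset[OF J(6)]) (auto intro!: inJ)
    then show "continuous_on {-\<delta><..<\<delta>} (\<lambda>t. v + \<sigma>' t *\<^sub>R normal q)" by (intro continuous_intros)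
  qed (use \<delta> J inJ s0 in \<open>auto simp: p_def\<close>)
qed

section \<open>The derivative of the normal\<close>

text \<open>
  The boundary lies on one side of its supporting hyperplane, so the distance of the curve from
  that hyperplane has a minimum at the point of contact.
\<close>

lemma velocity_orthogonal_normal:
  assumes "open I" "t \<in> I" "\<And>s. s \<in> I \<Longrightarrow> \<gamma> s \<in> \<Sigma>" and d: "(\<gamma> has_vector_derivative v) (at t)"
  shows "normal (\<gamma> t) \<bullet> v = 0"
proof -
  let ?h = "\<lambda>s. normal (\<gamma> t) \<bullet> (\<gamma> s - \<gamma> t)"
  have "((\<lambda>s. \<gamma> s - \<gamma> t) has_vector_derivative v) (at t)" using d by (auto intro!: derivative_eq_intros)
  then have "(?h has_vector_derivative normal (\<gamma> t) \<bullet> v) (at t)"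
    by (rule bounded_linear.has_vector_derivative[OF bounded_linear_inner_right])
  then have h: "(?h has_real_derivative normal (\<gamma> t) \<bullet> v) (at t)"
    by (simp add: has_real_derivative_iff_has_vector_derivative)
  obtain r where r: "r > 0" "ball t r \<subseteq> I" using assms by (meson openE)
  have "?h t \<le> ?h y" if "\<bar>t - y\<bar> < r" for y
  proof -
    have "\<gamma> y \<in> K" using r that assms(3) boundary_in_body by (auto simp: dist_real_def subset_iff)
    then show ?thesis using supporting_normal_normal[OF assms(3)[OF assms(2)]] by (simp add: supporting_normal_def)
  qed
  then show ?thesis using DERIV_local_min[OF h r(1)] by blast
qed

text \<open>
  The normal is defined on the boundary only. A derivative within the boundary is not unique as a
  linear map on the whole space, but its values on tangent vectors are: see \<open>normal_deriv_eq\<close>.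
\<close>

definition normal_deriv :: "'a \<Rightarrow> 'a \<Rightarrow> 'a" where
  "normal_deriv p = frechet_derivative normal (at p within \<Sigma>)"

lemma has_derivative_extension_normal:
  assumes "open U" "\<And>q. q \<in> U \<Longrightarrow> q \<in> \<Sigma> \<Longrightarrow> N q = normal q" "q \<in> U" "q \<in> \<Sigma>" "(N has_derivative D) (at q)"
  shows "(normal has_derivative D) (at q within \<Sigma>)"
proof -
  obtain d where d: "d > 0" "ball q d \<subseteq> U" using assms by (meson openE)
  show ?thesis
    by (rule has_derivative_transform_within[OF has_derivative_at_withinI[OF assms(5)] d(1)])
       (use assms d in \<open>auto simp: subset_iff dist_commute\<close>)
qed

lemma has_derivative_normal:
  assumes "p \<in> \<Sigma>"
  shows "(normal has_derivative normal_deriv p) (at p within \<Sigma>)"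
proof -
  obtain U N N' where U: "open U" "p \<in> U"
    "\<And>q. q \<in> U \<Longrightarrow> (N has_derivative blinfun_apply (N' q :: 'a \<Rightarrow>\<^sub>L 'a)) (at q)"
    "\<And>q. q \<in> U \<Longrightarrow> q \<in> \<Sigma> \<Longrightarrow> N q = normal q" using normal_extension[OF assms] by metis
  then have "normal differentiable (at p within \<Sigma>)"
    using has_derivative_extension_normal[OF U(1,4,2) assms U(3)[OF U(2)]] by (auto simp: differentiable_def)
  then show ?thesis unfolding normal_deriv_def by (simp add: frechet_derivative_works)
qed

lemma normal_along_curve:
  assumes "open I" "t \<in> I" "\<And>s. s \<in> I \<Longrightarrow> \<gamma> s \<in> \<Sigma>" and d: "(\<gamma> has_vector_derivative v) (at t)"
    and D: "(normal has_derivative D) (at (\<gamma> t) within \<Sigma>)"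
  shows "((\<lambda>s. normal (\<gamma> s)) has_vector_derivative D v) (at t)"
proof -
  have "(normal has_derivative D) (at (\<gamma> t) within \<gamma> ` I)"
    by (rule has_derivative_subset[OF D]) (use assms(3) in auto)
  then have "((normal \<circ> \<gamma>) has_vector_derivative D v) (at t within I)"
    by (rule vector_derivative_diff_chain_within[OF has_vector_derivative_at_within[OF d]])
  then show ?thesis unfolding o_def at_within_open[OF assms(2,1)] .
qed

text \<open>
  Both sides are the velocity of the normal along a curve in the boundary with velocity \<open>v\<close>.
\<close>

lemma normal_deriv_eq:
  assumes q: "q \<in> \<Sigma>" and D: "(normal has_derivative D) (at q within \<Sigma>)" and v: "normal q \<bullet> v = 0"
  shows "normal_deriv q v = D v"
proof -
  obtain \<delta> \<gamma> \<gamma>' where c: "\<delta> > 0" "\<And>t. \<bar>t\<bar> < \<delta> \<Longrightarrow> \<gamma> t \<in> \<Sigma>" "\<gamma> 0 = q" "\<gamma>' 0 = v"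
    "\<And>t. \<bar>t\<bar> < \<delta> \<Longrightarrow> (\<gamma> has_vector_derivative \<gamma>' t) (at t)" using curve_with_velocity[OF q v] by metis
  have "((\<lambda>s. normal (\<gamma> s)) has_vector_derivative E v) (at 0)" if "(normal has_derivative E) (at q within \<Sigma>)" for E
    by (rule normal_along_curve[of "{-\<delta><..<\<delta>}"]) (use c c(5)[of 0] that in auto)
  from vector_derivative_unique_at[OF this[OF has_derivative_normal[OF q]] this[OF D]] show ?thesis .
qed

lemma normal_deriv_local:
  assumes p: "p \<in> \<Sigma>"
  obtains U N' where "open U" "p \<in> U" "continuous_on U N'"
    "\<And>q. q \<in> U \<Longrightarrow> q \<in> \<Sigma> \<Longrightarrow> (normal has_derivative blinfun_apply (N' q :: 'a \<Rightarrow>\<^sub>L 'a)) (at q within \<Sigma>)"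
    "\<And>q v. q \<in> U \<Longrightarrow> q \<in> \<Sigma> \<Longrightarrow> normal q \<bullet> v = 0 \<Longrightarrow> normal_deriv q v = blinfun_apply (N' q) v"
proof -
  obtain U N N' where U: "open U" "p \<in> U" 
    "\<And>q. q \<in> U \<Longrightarrow> (N has_derivative blinfun_apply (N' q :: 'a \<Rightarrow>\<^sub>L 'a)) (at q)"
    "continuous_on U N'" "\<And>q. q \<in> U \<Longrightarrow> q \<in> \<Sigma> \<Longrightarrow> N q = normal q" using normal_extension[OF p] by metis
  have "(normal has_derivative blinfun_apply (N' q)) (at q within \<Sigma>)" if "q \<in> U" "q \<in> \<Sigma>" for q
    using has_derivative_extension_normal[OF U(1,5) that U(3)[OF that(1)]] .
  then show ?thesis using that[of U N'] U normal_deriv_eq by blast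
qed

lemma normal_deriv_symmetric:
  assumes p: "p \<in> \<Sigma>" and "normal p \<bullet> v = 0" "normal p \<bullet> w = 0"
  shows "normal_deriv p v \<bullet> w = normal_deriv p w \<bullet> v"
proof -
  obtain U N N' where U: "open U" "p \<in> U" 
    "\<And>q. q \<in> U \<Longrightarrow> (N has_derivative blinfun_apply (N' q :: 'a \<Rightarrow>\<^sub>L 'a)) (at q)"
    "continuous_on U N'" "\<And>q. q \<in> U \<Longrightarrow> q \<in> \<Sigma> \<Longrightarrow> N q = normal q"
    "\<And>q v w. q \<in> U \<Longrightarrow> q \<in> \<Sigma> \<Longrightarrow> normal q \<bullet> v = 0 \<Longrightarrow> normal q \<bullet> w = 0 \<Longrightarrow>
      blinfun_apply (N' q) v \<bullet> w = blinfun_apply (N' q) w \<bullet> v" using normal_extension[OF p] by blast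
  have "(normal has_derivative blinfun_apply (N' p)) (at p within \<Sigma>)"
    using has_derivative_extension_normal[OF U(1,5,2) p U(3)[OF U(2)]] .
  then show ?thesis using normal_deriv_eq[OF p] assms U(6)[OF U(2) p] by simp
qed

section \<open>The billiard map\<close>

lemma ray_meets_boundary_once:
  assumes "q \<in> \<Sigma>" "q + t *\<^sub>R w \<in> \<Sigma>" "q + s *\<^sub>R w \<in> \<Sigma>" "0 < t" "0 < s" "w \<noteq> 0"
  shows "t = s"
proof -
  have False if h: "q + t *\<^sub>R w \<in> \<Sigma>" "q + s *\<^sub>R w \<in> \<Sigma>" "0 < t" "t < s" for t s
  proof -
    have "q + t *\<^sub>R w = (1 - t / s) *\<^sub>R q + (t / s) *\<^sub>R (q + s *\<^sub>R w)"
      using h by (simp add: algebra_simps)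
    then have "q + t *\<^sub>R w \<in> open_segment q (q + s *\<^sub>R w)"
      using h assms(6) unfolding in_segment by (intro conjI exI[of _ "t / s"]) auto
    then show False
      using open_segment_interior[OF assms(1) h(2)] h assms(6) boundary_not_interior[OF h(1)] by auto
  qed
  then show ?thesis using assms by (metis linorder_cases)
qed

text \<open>
  If the open ray missed the interior, a hyperplane would separate them. It would support the body
  at \<open>q\<close>, so by uniqueness its normal would be \<open>normal q\<close>, and \<open>w\<close> would not point inwards.
\<close>

lemma ray_meets_boundary:
  assumes q: "q \<in> \<Sigma>" and w: "0 < normal q \<bullet> w"
  shows "\<exists>t>0. q + t *\<^sub>R w \<in> \<Sigma>"
proof -
  have w0: "w \<noteq> 0" using w by auto
  have "\<exists>s>0. q + s *\<^sub>R w \<in> interior K"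
  proof (rule ccontr)
    assume no: "\<not> ?thesis"
    define R where "R = (\<lambda>s. q + s *\<^sub>R w) ` {0<..}"
    have "convex R"
    proof -
      have "R = (\<lambda>v. q + v) ` ((\<lambda>s. s *\<^sub>R w) ` {0<..})" by (auto simp: R_def)
      moreover have "convex ((\<lambda>s. s *\<^sub>R w) ` {0<..})"
        by (rule convex_linear_image) (auto simp: linear_iff scaleR_add_left)
      ultimately show ?thesis using convex_translation by metis
    qed
    moreover have "R \<inter> interior K = {}" using no by (auto simp: R_def)
    ultimately obtain a b where a: "a \<noteq> 0" "\<forall>x\<in>R. a \<bullet> x \<le> b" "\<forall>x\<in>interior K. b \<le> a \<bullet> x"
      using separating_hyperplane_sets[of R "interior K"] body by (auto simp: convex_interior R_def)
    have K: "\<forall>y\<in>K. b \<le> a \<bullet> y" using a(3) by (rule body_in_halfspace)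
    have R: "a \<bullet> q + s * (a \<bullet> w) \<le> b" if "s > 0" for s
      using a(2) that by (auto simp: R_def inner_add_right)
    have bq: "b \<le> a \<bullet> q" using K q boundary_in_body by blast
    have "a \<bullet> q \<le> b + e" if "e > 0" for e
    proof -
      define s where "s = e / (\<bar>a \<bullet> w\<bar> + 1)"
      have s: "s > 0" using that by (simp add: s_def add_nonneg_pos)
      have "s * - (a \<bullet> w) \<le> s * (\<bar>a \<bullet> w\<bar> + 1)" using s by (intro mult_left_mono) auto
      also have "\<dots> = e" by (simp add: s_def add_nonneg_eq_0_iff)
      finally show ?thesis using R[OF s] by simp
    qed
    then have "a \<bullet> q \<le> b" by (rule field_le_epsilon)
    then have bq: "b = a \<bullet> q" using bq by simp
    then have aw: "a \<bullet> w \<le> 0" using R[of 1] by simp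
    have "supporting_normal q (a /\<^sub>R norm a)"
      using a(1) K bq by (auto simp: supporting_normal_def inner_diff_right)
    then have "normal q = a /\<^sub>R norm a" using normal_eqI q by blast
    then have "0 < (a \<bullet> w) / norm a" using w by (simp add: divide_inverse_commute)
    then show False using aw a(1) by (simp add: zero_less_divide_iff)
  qed
  then obtain s where s: "s > 0" "q + s *\<^sub>R w \<in> interior K" by blast
  obtain d where d: "0 < d" "q + s *\<^sub>R w + d *\<^sub>R w \<in> \<Sigma>"
    using ray_to_frontier[OF body(5) s(2) w0] by metis
  then show ?thesis using s by (intro exI[of _ "s + d"]) (simp add: algebra_simps)
qed

definition reflect :: "'a \<Rightarrow> 'a \<Rightarrow> 'a" where
  "reflect q d = d - (2 * (normal q \<bullet> d)) *\<^sub>R normal q"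

text \<open>
  The second point in which the reflected ray meets the boundary; it is unique by strict
  convexity.
\<close>

definition bounce :: "'a \<Rightarrow> 'a \<Rightarrow> 'a" where
  "bounce p q = (SOME z. z \<in> \<Sigma> \<and> (\<exists>t>0. z = q + t *\<^sub>R reflect q (q - p)))"

lemma normal_reflect: "q \<in> \<Sigma> \<Longrightarrow> normal q \<bullet> reflect q d = - (normal q \<bullet> d)"
  by (simp add: reflect_def inner_diff_right normal_inner_normal)

lemma norm_reflect: "q \<in> \<Sigma> \<Longrightarrow> norm (reflect q d) = norm d"
proof -
  assume "q \<in> \<Sigma>"
  then have "reflect q d \<bullet> reflect q d = d \<bullet> d"
    by (simp add: reflect_def inner_diff_right inner_diff_left normal_inner_normal inner_commute)
  then show ?thesis by (simp add: norm_eq_sqrt_inner)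
qed

lemma reflect_scaleR: "reflect q (c *\<^sub>R d) = c *\<^sub>R reflect q d"
  by (simp add: reflect_def scaleR_diff_right)

lemma reflect_inner_tangent: "normal q \<bullet> w = 0 \<Longrightarrow> reflect q d \<bullet> w = d \<bullet> w"
  by (simp add: reflect_def inner_diff_left)

lemma normal_reflect_pos:
  assumes "p \<in> \<Sigma>" "q \<in> \<Sigma>" "p \<noteq> q"
  shows "0 < normal q \<bullet> reflect q (q - p)"
  using normal_pos[OF assms(2) boundary_in_body[OF assms(1)] assms(3)] assms(2)
  by (simp add: normal_reflect inner_diff_right)

lemma bounce_ray:
  assumes "p \<in> \<Sigma>" "q \<in> \<Sigma>" "p \<noteq> q"
  shows "bounce p q \<in> \<Sigma> \<and> (\<exists>t>0. bounce p q = q + t *\<^sub>R reflect q (q - p))"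
proof -
  have "\<exists>z. z \<in> \<Sigma> \<and> (\<exists>t>0. z = q + t *\<^sub>R reflect q (q - p))"
    using ray_meets_boundary[OF assms(2) normal_reflect_pos[OF assms]] by blast
  then show ?thesis unfolding bounce_def by (rule someI_ex)
qed

lemma bounce_eqI:
  assumes "p \<in> \<Sigma>" "q \<in> \<Sigma>" "p \<noteq> q" "t > 0" "q + t *\<^sub>R reflect q (q - p) \<in> \<Sigma>"
  shows "bounce p q = q + t *\<^sub>R reflect q (q - p)"
proof -
  obtain s where s: "s > 0" "bounce p q = q + s *\<^sub>R reflect q (q - p)" "bounce p q \<in> \<Sigma>"
    using bounce_ray[OF assms(1-3)] by blast
  have "reflect q (q - p) \<noteq> 0" using normal_reflect_pos[OF assms(1-3)] by auto
  then have "t = s" using ray_meets_boundary_once[OF assms(2,5)] s assms(4) by simp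
  then show ?thesis using s by simp
qed

lemma bounce_boundary: "p \<in> \<Sigma> \<Longrightarrow> q \<in> \<Sigma> \<Longrightarrow> p \<noteq> q \<Longrightarrow> bounce p q \<in> \<Sigma>"
  using bounce_ray by blast

lemma bounce_neq: "p \<in> \<Sigma> \<Longrightarrow> q \<in> \<Sigma> \<Longrightarrow> p \<noteq> q \<Longrightarrow> bounce p q \<noteq> q"
  using bounce_ray[of p q] normal_reflect_pos[of p q] by force

lemma sgn_bounce:
  assumes "p \<in> \<Sigma>" "q \<in> \<Sigma>" "p \<noteq> q"
  shows "sgn (bounce p q - q) = reflect q (sgn (q - p))"
proof -
  obtain t where t: "t > 0" "bounce p q = q + t *\<^sub>R reflect q (q - p)" using bounce_ray[OF assms] by blast
  then have "sgn (bounce p q - q) = sgn (reflect q (q - p))" by (simp add: sgn_scaleR)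
  then show ?thesis using assms(2) by (simp add: sgn_div_norm norm_reflect reflect_scaleR)
qed

text \<open>
  The reflection law for unit vectors, as it arises from critical points of length.
\<close>

lemma bounce_eqI_sgn:
  assumes "p \<in> \<Sigma>" "q \<in> \<Sigma>" "p \<noteq> q" "z \<in> \<Sigma>" "z \<noteq> q" "sgn (z - q) = reflect q (sgn (q - p))"
  shows "bounce p q = z"
proof -
  define t where "t = norm (z - q) / norm (q - p)"
  have "z - q = norm (z - q) *\<^sub>R sgn (z - q)" using assms(5) by (simp add: sgn_div_norm)
  also have "\<dots> = t *\<^sub>R reflect q (q - p)"
    unfolding assms(6) sgn_div_norm[of "q - p"] by (simp add: reflect_scaleR t_def divide_inverse)
  finally have "z = q + t *\<^sub>R reflect q (q - p)" by (simp add: algebra_simps)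
  moreover have "t > 0" using assms by (simp add: t_def)
  ultimately show ?thesis using bounce_eqI assms by metis
qed

text \<open>
  Reflection does not change the component of the unit direction along the tangent space. Hence
  the derivative of the length telescopes, with zero boundary terms because the end points are
  fixed.
\<close>

lemma billiard_configuration_bounce:
  assumes X: "\<And>n. X n \<in> \<Sigma>" "\<And>n. X n \<noteq> X (Suc n)" "\<And>n. X (Suc (Suc n)) = bounce (X n) (X (Suc n))"
  shows "billiard_configuration \<Sigma> X"
  unfolding billiard_configuration_def critical_point_on_def
proof (intro conjI allI impI ballI)
  fix M N :: nat and c :: "real \<Rightarrow> nat \<Rightarrow> 'a"
  assume MN: "1 \<le> M \<and> M \<le> N" and c: "\<forall>i\<in>{M..N}. (\<forall>t. c t i \<in> \<Sigma>) \<and> c 0 i = X i \<and> (\<lambda>t. c t i) differentiable at 0"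
  obtain m where m: "M = Suc m" using MN by (cases M) auto
  (* the end points are regarded as constant curves, so that all summands have the same form *)
  define C where "C t i = (if i \<in> {M..N} then c t i else X i)" for t i
  define v where "v i = (if i \<in> {M..N} then vector_derivative (\<lambda>t. c t i) (at 0) else 0)" for i
  define e where "e i = sgn (X (Suc i) - X i)" for i
  have C0: "C 0 i = X i" for i using c by (simp add: C_def)
  have C_deriv: "((\<lambda>t. C t i) has_vector_derivative v i) (at 0)" for i
    using c by (auto simp: C_def v_def vector_derivative_works)
  have tangent: "e i \<bullet> v (Suc i) = e (Suc i) \<bullet> v (Suc i)" for i
  proof (cases "Suc i \<in> {M..N}")
    case True
    have "normal (C 0 (Suc i)) \<bullet> v (Suc i) = 0"
      by (rule velocity_orthogonal_normal[OF open_UNIV UNIV_I _ C_deriv]) (use c True in \<open>simp add: C_def\<close>)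
    then have "reflect (X (Suc i)) (e i) \<bullet> v (Suc i) = e i \<bullet> v (Suc i)"
      by (simp add: C0 reflect_inner_tangent)
    moreover have "e (Suc i) = reflect (X (Suc i)) (e i)"
      using sgn_bounce[OF X(1) X(1) X(2), of i] by (simp add: e_def X(3))
    ultimately show ?thesis by simp
  next
    case False
    then have "v (Suc i) = 0" unfolding v_def by (rule if_not_P)
    then show ?thesis by simp
  qed
  have len: "billiard_length X M N (c t) = (\<Sum>i=m..N. dist (C t i) (C t (Suc i)))" for t
  proof -
    have "(\<Sum>i=m..N. dist (C t i) (C t (Suc i)))
        = dist (C t m) (C t M) + (\<Sum>i=M..<N. dist (C t i) (C t (Suc i))) + dist (C t N) (C t (Suc N))"
      using MN m by (simp add: sum.atLeast_Suc_lessThan flip: atLeastLessThanSuc_atLeastAtMost)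
    also have "(\<Sum>i=M..<N. dist (C t i) (C t (Suc i))) = (\<Sum>i=M..<N. dist (c t i) (c t (i + 1)))"
      by (intro sum.cong) (auto simp: C_def)
    finally show ?thesis using MN m by (simp add: billiard_length_def C_def)
  qed
  have "((\<lambda>t. \<Sum>i=m..N. dist (C t i) (C t (Suc i))) has_real_derivative (\<Sum>i=m..N. e i \<bullet> (v (Suc i) - v i))) (at 0)"
  proof (rule DERIV_sum)
    fix i
    show "((\<lambda>t. dist (C t i) (C t (Suc i))) has_real_derivative e i \<bullet> (v (Suc i) - v i)) (at 0)"
      using has_vector_derivative_dist[OF C_deriv[of i] C_deriv[of "Suc i"]] X(2)[of i] by (simp add: C0 e_def)
  qed
  also have "(\<Sum>i=m..N. e i \<bullet> (v (Suc i) - v i)) = (\<Sum>i=m..N. e (Suc i) \<bullet> v (Suc i) - e i \<bullet> v i)"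
    by (simp add: inner_diff_right tangent)
  also have "\<dots> = e (Suc N) \<bullet> v (Suc N) - e m \<bullet> v m"
    using MN m by (subst sum_Suc_diff) auto
  also have "\<dots> = 0" using m by (simp add: v_def)
  finally show "((\<lambda>t. billiard_length X M N (c t)) has_real_derivative 0) (at 0)" by (simp add: len)
qed (use X in auto)

fun orbit :: "'a \<Rightarrow> 'a \<Rightarrow> nat \<Rightarrow> 'a" where
  "orbit x u 0 = x"
| "orbit x u (Suc 0) = u"
| "orbit x u (Suc (Suc n)) = bounce (orbit x u n) (orbit x u (Suc n))"

lemma orbit_boundary:
  assumes "x \<in> \<Sigma>" "u \<in> \<Sigma>" "x \<noteq> u"
  shows "orbit x u n \<in> \<Sigma> \<and> orbit x u (Suc n) \<in> \<Sigma> \<and> orbit x u n \<noteq> orbit x u (Suc n)"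
proof (induction n)
  case (Suc n)
  then show ?case using bounce_boundary bounce_neq by (metis orbit.simps(3))
qed (use assms in auto)

lemma billiard_configuration_orbit:
  assumes "x \<in> \<Sigma>" "u \<in> \<Sigma>" "x \<noteq> u"
  shows "billiard_configuration \<Sigma> (orbit x u)"
  using orbit_boundary[OF assms] by (intro billiard_configuration_bounce) auto

lemma normal_C1_differentiable_on:
  assumes I: "open I" "\<And>t. t \<in> I \<Longrightarrow> \<gamma> t \<in> \<Sigma>" "\<gamma> C1_differentiable_on I"
  shows "(\<lambda>t. normal (\<gamma> t)) C1_differentiable_on I"
proof (rule C1_differentiable_on_locally)
  fix s assume s: "s \<in> I"
  obtain \<gamma>' where g: "\<And>t. t \<in> I \<Longrightarrow> (\<gamma> has_vector_derivative \<gamma>' t) (at t)" "continuous_on I \<gamma>'"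
    using I(3) unfolding C1_differentiable_on_def by blast
  have cg: "continuous_on I \<gamma>" using g(1) by (rule has_vector_derivative_imp_continuous_on)
  obtain U N' where U: "open U" "\<gamma> s \<in> U" "continuous_on U N'"
    "\<And>q. q \<in> U \<Longrightarrow> q \<in> \<Sigma> \<Longrightarrow> (normal has_derivative blinfun_apply (N' q :: 'a \<Rightarrow>\<^sub>L 'a)) (at q within \<Sigma>)"
    using normal_deriv_local[OF I(2)[OF s]] by metis
  define J where "J = {t \<in> I. \<gamma> t \<in> U}"
  have J: "open J" using continuous_open_preimage[OF cg I(1) U(1)] by (auto simp: J_def vimage_def Int_def)
  have "((\<lambda>t. normal (\<gamma> t)) has_vector_derivative blinfun_apply (N' (\<gamma> t)) (\<gamma>' t)) (at t)" if "t \<in> J" for t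
    by (rule normal_along_curve[OF J that]) (use that I U(4) g in \<open>auto simp: J_def\<close>)
  moreover have "continuous_on J (\<lambda>t. blinfun_apply (N' (\<gamma> t)) (\<gamma>' t))"
  proof -
    have "continuous_on J \<gamma>" "continuous_on J \<gamma>'"
      using cg g(2) continuous_on_subset[of I _ J] by (auto simp: J_def)
    then show ?thesis
      by (intro continuous_intros continuous_on_compose2[OF U(3)]) (auto simp: J_def)
  qed
  ultimately show "\<exists>J. open J \<and> s \<in> J \<and> (\<lambda>t. normal (\<gamma> t)) C1_differentiable_on J"
    using J s U(2) unfolding C1_differentiable_on_def
    by (intro exI[of _ J] conjI exI[of _ "\<lambda>t. blinfun_apply (N' (\<gamma> t)) (\<gamma>' t)"]) (auto simp: J_def)
qed

text \<open>
  A trajectory segment ends transversally, since the starting point lies strictly inside the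
  supporting half-space at its end. So the time of arrival depends differentiably on the segment,
  and it is the only positive one.
\<close>

lemma bounce_C1_differentiable_on:
  assumes I: "open I" and A: "A C1_differentiable_on I" "\<And>t. t \<in> I \<Longrightarrow> A t \<in> \<Sigma>"
    and B: "B C1_differentiable_on I" "\<And>t. t \<in> I \<Longrightarrow> B t \<in> \<Sigma>" and ne: "\<And>t. t \<in> I \<Longrightarrow> A t \<noteq> B t"
  shows "(\<lambda>t. bounce (A t) (B t)) C1_differentiable_on I"
proof (rule C1_differentiable_on_locally)
  fix s assume s: "s \<in> I"
  define w where "w t = reflect (B t) (B t - A t)" for t
  have w: "w C1_differentiable_on I"
    unfolding w_def reflect_def
    by (intro C1_differentiable_on_diff C1_differentiable_on_scaleR C1_differentiable_on_mult
        C1_differentiable_on_const C1_differentiable_on_inner normal_C1_differentiable_on A B I) auto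
  obtain w' where w': "\<And>t. t \<in> I \<Longrightarrow> (w has_vector_derivative w' t) (at t)" "continuous_on I w'"
    using w unfolding C1_differentiable_on_def by blast
  obtain B' where B': "\<And>t. t \<in> I \<Longrightarrow> (B has_vector_derivative B' t) (at t)" "continuous_on I B'"
    using B(1) unfolding C1_differentiable_on_def by blast
  obtain a where a: "a > 0" "bounce (A s) (B s) = B s + a *\<^sub>R w s" "bounce (A s) (B s) \<in> \<Sigma>"
    using bounce_ray[OF A(2)[OF s] B(2)[OF s] ne[OF s]] by (auto simp: w_def)
  define z where "z = B s + a *\<^sub>R w s"
  have z: "z \<in> \<Sigma>" using a by (simp add: z_def)
  have nz: "normal z \<bullet> w s \<noteq> 0"
  proof -
    have "B s \<noteq> z" using bounce_neq[OF A(2)[OF s] B(2)[OF s] ne[OF s]] a by (simp add: z_def)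
    then have "0 < normal z \<bullet> (B s - z)" using normal_pos[OF z] boundary_in_body[OF B(2)[OF s]] by blast
    then show ?thesis by (auto simp: z_def)
  qed
  obtain J \<sigma> \<sigma>' where J: "open J" "J \<subseteq> I" "s \<in> J" "\<sigma> s = a"
    "\<And>t. t \<in> J \<Longrightarrow> B t + \<sigma> t *\<^sub>R w t \<in> \<Sigma>"
    "\<And>t. t \<in> J \<Longrightarrow> (\<sigma> has_vector_derivative \<sigma>' t) (at t)" "continuous_on J \<sigma>'"
    by (rule boundary_hit_curve[OF I s B' w' z[unfolded z_def] nz[unfolded z_def]]) blast+
  have cs: "continuous_on J \<sigma>" using J(6) by (rule has_vector_derivative_imp_continuous_on)
  define J' where "J' = {t \<in> J. \<sigma> t \<in> {0<..}}"
  have J': "open J'" using continuous_open_preimage[OF cs J(1), of "{0<..}"] by (auto simp: J'_def vimage_def Int_def)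
  have sub: "J' \<subseteq> J" "J' \<subseteq> I" using J by (auto simp: J'_def)
  have "\<sigma> C1_differentiable_on J'"
    using J(6,7) sub continuous_on_subset unfolding C1_differentiable_on_def by blast
  then have "(\<lambda>t. B t + \<sigma> t *\<^sub>R w t) C1_differentiable_on J'"
    using C1_differentiable_on_subset[OF B(1) sub(2)] C1_differentiable_on_subset[OF w sub(2)]
    by (intro C1_differentiable_on_add C1_differentiable_on_scaleR)
  moreover have "B t + \<sigma> t *\<^sub>R w t = bounce (A t) (B t)" if "t \<in> J'" for t
    using bounce_eqI[of "A t" "B t" "\<sigma> t"] A B ne that sub J(5) by (auto simp: J'_def w_def)
  ultimately have "(\<lambda>t. bounce (A t) (B t)) C1_differentiable_on J'"
    by (rule C1_differentiable_on_cong[OF J'])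
  then show "\<exists>J. open J \<and> s \<in> J \<and> (\<lambda>t. bounce (A t) (B t)) C1_differentiable_on J"
    using J' J(3,4) a(1) by (intro exI[of _ J']) (auto simp: J'_def)
qed

lemma orbit_C1_differentiable_on:
  assumes "open I" "x \<in> \<Sigma>" "u C1_differentiable_on I" "\<And>t. t \<in> I \<Longrightarrow> u t \<in> \<Sigma>" "\<And>t. t \<in> I \<Longrightarrow> x \<noteq> u t"
  shows "(\<lambda>t. orbit x (u t) n) C1_differentiable_on I \<and> (\<lambda>t. orbit x (u t) (Suc n)) C1_differentiable_on I"
proof (induction n)
  case (Suc n)
  then have "(\<lambda>t. bounce (orbit x (u t) n) (orbit x (u t) (Suc n))) C1_differentiable_on I"
    using orbit_boundary assms by (intro bounce_C1_differentiable_on) auto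
  then show ?case using Suc by simp
qed (use assms in auto)

text \<open>
  The tangent space is defined by curves that stay in the boundary for all times, so a local curve
  is extended by a constant.
\<close>

lemma velocity_in_tangent_space:
  assumes "\<delta> > 0" "\<And>t. \<bar>t\<bar> < \<delta> \<Longrightarrow> \<gamma> t \<in> \<Sigma>" "(\<gamma> has_vector_derivative v) (at 0)"
  shows "v \<in> tangent_space \<Sigma> (\<gamma> 0)"
proof -
  define \<beta> where "\<beta> t = (if \<bar>t\<bar> < \<delta> then \<gamma> t else \<gamma> 0)" for t
  have "(\<beta> has_vector_derivative v) (at 0)"
    by (rule has_vector_derivative_transform_within_open[OF assms(3), of "{-\<delta><..<\<delta>}"]) (use assms(1) in \<open>auto simp: \<beta>_def\<close>)
  moreover have "\<beta> t \<in> \<Sigma>" for t using assms by (auto simp: \<beta>_def)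
  ultimately show ?thesis unfolding tangent_space_def using assms(1) by (intro CollectI exI[of _ \<beta>]) (auto simp: \<beta>_def)
qed

section \<open>The second variation of length\<close>

text \<open>
  The Hessian at \<open>u\<close> of \<open>p \<mapsto> |x - p| + |p - z|\<close> restricted to the boundary, where \<open>z = bounce x u\<close>
  is kept fixed. The unit direction from \<open>u\<close> to \<open>z\<close> has the same tangential part as the one from
  \<open>x\<close> to \<open>u\<close>, so the two projection terms combine. The last term is the second fundamental form,
  weighted by the jump of the direction at \<open>u\<close>.
\<close>

definition length_hessian :: "'a \<Rightarrow> 'a \<Rightarrow> 'a \<Rightarrow> 'a \<Rightarrow> real" where
  "length_hessian x u v w =
     (1 / norm (u - x) + 1 / norm (bounce x u - u)) * (v \<bullet> w - (sgn (u - x) \<bullet> v) * (sgn (u - x) \<bullet> w))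
     - 2 * (normal u \<bullet> sgn (u - x)) * (normal_deriv u v \<bullet> w)"

text \<open>
  The vector that is differentiated vanishes at \<open>t = 0\<close>; this is the reflection law, with the
  factor of the normal frozen at its initial value. The lemma serves twice: with \<open>z\<close> following the
  billiard map it gives the linearised reflection law, and with \<open>z\<close> fixed it gives the second
  variation of length.
\<close>

lemma first_variation_derivative:
  assumes x: "x \<in> \<Sigma>" and I: "open I" "0 \<in> I" "\<And>t. t \<in> I \<Longrightarrow> \<gamma> t \<in> \<Sigma>" and ne: "x \<noteq> \<gamma> 0"
    and g: "(\<gamma> has_vector_derivative v) (at 0)" and z: "(z has_vector_derivative \<zeta>) (at 0)"
    and z0: "z 0 = bounce x (\<gamma> 0)"
  obtains m where
    "((\<lambda>t. sgn (\<gamma> t - x) - sgn (z t - \<gamma> t) - (2 * (normal (\<gamma> 0) \<bullet> sgn (\<gamma> 0 - x))) *\<^sub>R normal (\<gamma> t))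
       has_vector_derivative m) (at 0)"
    "\<And>w. normal (\<gamma> 0) \<bullet> w = 0 \<Longrightarrow> m \<bullet> w = length_hessian x (\<gamma> 0) v w
       - (\<zeta> - (sgn (z 0 - \<gamma> 0) \<bullet> \<zeta>) *\<^sub>R sgn (z 0 - \<gamma> 0)) \<bullet> w / norm (z 0 - \<gamma> 0)"
proof -
  define u a b where "u = \<gamma> 0" "a = sgn (u - x)" "b = sgn (z 0 - u)"
  have u: "u \<in> \<Sigma>" "x \<noteq> u" "z 0 \<noteq> u" using I ne z0 bounce_neq[OF x] by (auto simp: u_a_b_def)
  have b: "b = reflect u a" using sgn_bounce[OF x u(1,2)] z0 by (simp add: u_a_b_def)
  have vt: "normal u \<bullet> v = 0" using velocity_orthogonal_normal[OF I g] by (simp add: u_a_b_def)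
  define m where "m = (v - (a \<bullet> v) *\<^sub>R a) /\<^sub>R norm (u - x)
      - ((\<zeta> - v) - (b \<bullet> (\<zeta> - v)) *\<^sub>R b) /\<^sub>R norm (z 0 - u) - (2 * (normal u \<bullet> a)) *\<^sub>R normal_deriv u v"
  show ?thesis
  proof (rule that[of m])
    have 1: "((\<lambda>t. sgn (\<gamma> t - x)) has_vector_derivative (v - (a \<bullet> v) *\<^sub>R a) /\<^sub>R norm (u - x)) (at 0)"
      using has_vector_derivative_sgn[OF has_vector_derivative_diff[OF g has_vector_derivative_const], of x] ne
      by (simp add: u_a_b_def)
    have 2: "((\<lambda>t. sgn (z t - \<gamma> t)) has_vector_derivative ((\<zeta> - v) - (b \<bullet> (\<zeta> - v)) *\<^sub>R b) /\<^sub>R norm (z 0 - u)) (at 0)"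
      using has_vector_derivative_sgn[OF has_vector_derivative_diff[OF z g]] u by (simp add: u_a_b_def)
    have 3: "((\<lambda>t. normal (\<gamma> t)) has_vector_derivative normal_deriv u v) (at 0)"
      using normal_along_curve[OF I g] has_derivative_normal u(1) by (simp add: u_a_b_def)
    have 4: "((\<lambda>t. (2 * (normal u \<bullet> a)) *\<^sub>R normal (\<gamma> t)) has_vector_derivative (2 * (normal u \<bullet> a)) *\<^sub>R normal_deriv u v) (at 0)"
      by (rule bounded_linear.has_vector_derivative[OF bounded_linear_scaleR_right 3])
    show "((\<lambda>t. sgn (\<gamma> t - x) - sgn (z t - \<gamma> t) - (2 * (normal (\<gamma> 0) \<bullet> sgn (\<gamma> 0 - x))) *\<^sub>R normal (\<gamma> t))
       has_vector_derivative m) (at 0)"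
      unfolding m_def using has_vector_derivative_diff[OF has_vector_derivative_diff[OF 1 2] 4]
      by (simp add: u_a_b_def)
    fix w assume w: "normal (\<gamma> 0) \<bullet> w = 0"
    have bw: "b \<bullet> w = a \<bullet> w" "b \<bullet> v = a \<bullet> v" using w vt by (simp_all add: b reflect_inner_tangent u_a_b_def(1))
    have "m \<bullet> w = (v \<bullet> w - (a \<bullet> v) * (a \<bullet> w)) / norm (u - x) - ((\<zeta> \<bullet> w - v \<bullet> w) - (b \<bullet> \<zeta> - b \<bullet> v) * (b \<bullet> w)) / norm (z 0 - u)
       - 2 * (normal u \<bullet> a) * (normal_deriv u v \<bullet> w)"
      by (simp add: m_def inner_diff_left inner_diff_right divide_inverse_commute)
    also have "\<dots> = (v \<bullet> w - (a \<bullet> v) * (a \<bullet> w)) / norm (u - x) + (v \<bullet> w - (a \<bullet> v) * (a \<bullet> w)) / norm (z 0 - u)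
       - 2 * (normal u \<bullet> a) * (normal_deriv u v \<bullet> w) - (\<zeta> \<bullet> w - (b \<bullet> \<zeta>) * (b \<bullet> w)) / norm (z 0 - u)"
      unfolding bw by (simp add: algebra_simps diff_divide_distrib add_divide_distrib)
    also have "\<dots> = length_hessian x u v w - (\<zeta> - (b \<bullet> \<zeta>) *\<^sub>R b) \<bullet> w / norm (z 0 - u)"
      using z0 by (simp add: length_hessian_def u_a_b_def inner_diff_left distrib_right)
    finally show "m \<bullet> w = length_hessian x (\<gamma> 0) v w
       - (\<zeta> - (sgn (z 0 - \<gamma> 0) \<bullet> \<zeta>) *\<^sub>R sgn (z 0 - \<gamma> 0)) \<bullet> w / norm (z 0 - \<gamma> 0)"
      by (simp add: u_a_b_def)
  qed
qed

text \<open>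
  Along the variation the reflection law holds identically, so the derivative in
  \<open>first_variation_derivative\<close> is a multiple of the normal. If \<open>v\<close> is in the kernel, this says
  that the part of \<open>\<xi>\<^sub>2\<close> orthogonal to the outgoing direction is normal to the boundary at \<open>u\<close>,
  hence zero by transversality at \<open>u\<close>. So \<open>\<xi>\<^sub>2\<close> is parallel to the outgoing segment, and being
  tangent at the end of it, it vanishes by transversality there.
\<close>

lemma conjugate_points_of_kernel:
  assumes x: "x \<in> \<Sigma>" and u: "u \<in> \<Sigma>" "x \<noteq> u" and v: "v \<noteq> 0" "normal u \<bullet> v = 0"
    and ker: "\<And>w. normal u \<bullet> w = 0 \<Longrightarrow> length_hessian x u v w = 0"
  shows "conjugate_points \<Sigma> (orbit x u) 0 2"
proof -
  obtain \<delta>' \<gamma> \<gamma>' where c: "\<delta>' > 0" "\<And>t. \<bar>t\<bar> < \<delta>' \<Longrightarrow> \<gamma> t \<in> \<Sigma>" "\<gamma> 0 = u" "\<gamma>' 0 = v"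
    "\<And>t. \<bar>t\<bar> < \<delta>' \<Longrightarrow> (\<gamma> has_vector_derivative \<gamma>' t) (at t)" "continuous_on {-\<delta>'<..<\<delta>'} \<gamma>'"
    by (rule curve_with_velocity[OF u(1) v(2)]) blast
  have "isCont \<gamma> 0" using c(5)[of 0] c(1) by (simp add: has_vector_derivative_continuous)
  then have "eventually (\<lambda>t. \<gamma> t \<noteq> x) (at 0)"
    using u(2) c(3) by (intro tendsto_imp_eventually_ne) (auto simp: isCont_def)
  then obtain \<delta>'' where d2: "\<delta>'' > 0" "\<And>t. t \<noteq> 0 \<Longrightarrow> \<bar>t\<bar> < \<delta>'' \<Longrightarrow> \<gamma> t \<noteq> x"
    by (auto simp: eventually_at)
  define \<delta> where "\<delta> = min \<delta>' \<delta>''"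
  have \<delta>: "\<delta> > 0" using c(1) d2(1) by (simp add: \<delta>_def)
  define I where "I = {-\<delta><..<\<delta>}"
  have I: "open I" "0 \<in> I" using \<delta> by (auto simp: I_def)
  have gI: "\<gamma> t \<in> \<Sigma>" "x \<noteq> \<gamma> t" "(\<gamma> has_vector_derivative \<gamma>' t) (at t)" if "t \<in> I" for t
  proof -
    have t: "\<bar>t\<bar> < \<delta>'" "\<bar>t\<bar> < \<delta>''" using that by (auto simp: I_def \<delta>_def)
    show "\<gamma> t \<in> \<Sigma>" "(\<gamma> has_vector_derivative \<gamma>' t) (at t)" using c(2,5) t by blast+
    show "x \<noteq> \<gamma> t" using d2(2)[OF _ t(2)] c(3) u(2) by (cases "t = 0") auto
  qed
  have "continuous_on I \<gamma>'" by (rule continuous_on_subset[OF c(6)]) (auto simp: I_def \<delta>_def)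
  then have "\<gamma> C1_differentiable_on I" using gI(3) unfolding C1_differentiable_on_def by blast
  then have orb: "(\<lambda>t. orbit x (\<gamma> t) n) C1_differentiable_on I" for n
    using orbit_C1_differentiable_on[where u=\<gamma>, OF I(1) x _ gI(1,2)] by blast
  define \<xi> where "\<xi> n = vector_derivative (\<lambda>t. orbit x (\<gamma> t) n) (at 0)" for n
  have \<xi>: "((\<lambda>t. orbit x (\<gamma> t) n) has_vector_derivative \<xi> n) (at 0)" for n
    using orb[of n] I(2) unfolding C1_differentiable_on_eq \<xi>_def by (simp add: vector_derivative_works)
  have \<xi>0: "\<xi> 0 = 0" using vector_derivative_unique_at[OF \<xi>[of 0]] by (simp add: has_vector_derivative_const)
  have \<xi>1: "\<xi> 1 = v" using vector_derivative_unique_at[OF \<xi>[of 1]] gI(3)[OF I(2)] c(4) by simp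
  have onS: "orbit x (\<gamma> t) n \<in> \<Sigma>" if "t \<in> I" for t n using orbit_boundary x gI that by blast
  have \<xi>2: "\<xi> 2 = 0"
  proof -
    define z where "z t = bounce x (\<gamma> t)" for t
    define a where "a t = sgn (\<gamma> t - x)" for t
    define b where "b = sgn (z 0 - u)"
    define \<zeta> where "\<zeta> = \<xi> 2"
    have z: "(z has_vector_derivative \<zeta>) (at 0)"
      using \<xi>[of 2] by (simp add: \<zeta>_def z_def[abs_def] numeral_2_eq_2)
    have zS: "z t \<in> \<Sigma>" if "t \<in> I" for t using onS[OF that, of 2] by (simp add: z_def numeral_2_eq_2)
    have zu: "z 0 \<noteq> u" using bounce_neq[OF x u] c(3) by (simp add: z_def)
    (* the reflection law along the variation reads a - b = \<kappa> times the normal *)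
    define \<kappa> where "\<kappa> t = 2 * (normal (\<gamma> t) \<bullet> a t)" for t
    obtain m where m: "((\<lambda>t. sgn (\<gamma> t - x) - sgn (z t - \<gamma> t) - (2 * (normal (\<gamma> 0) \<bullet> sgn (\<gamma> 0 - x))) *\<^sub>R normal (\<gamma> t))
       has_vector_derivative m) (at 0)"
      "\<And>w. normal (\<gamma> 0) \<bullet> w = 0 \<Longrightarrow> m \<bullet> w = length_hessian x (\<gamma> 0) v w
       - (\<zeta> - (sgn (z 0 - \<gamma> 0) \<bullet> \<zeta>) *\<^sub>R sgn (z 0 - \<gamma> 0)) \<bullet> w / norm (z 0 - \<gamma> 0)"
      by (rule first_variation_derivative[OF x I gI(1) gI(2)[OF I(2)] gI(3)[OF I(2)] z]) (auto simp: z_def c(4))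
    have nd: "((\<lambda>t. normal (\<gamma> t)) has_vector_derivative normal_deriv u v) (at 0)"
      using normal_along_curve[OF I gI(1) gI(3)[OF I(2)]] has_derivative_normal[OF u(1)] c(3,4) by simp
    have "(a has_vector_derivative (v - (a 0 \<bullet> v) *\<^sub>R a 0) /\<^sub>R norm (u - x)) (at 0)"
      unfolding a_def
      using has_vector_derivative_sgn[OF has_vector_derivative_diff[OF gI(3)[OF I(2)] has_vector_derivative_const], of x] gI(2)[OF I(2)] c(3,4)
      by simp
    then have "\<exists>k. (\<kappa> has_vector_derivative k) (at 0)"
      unfolding \<kappa>_def
      by (intro exI) (rule bounded_linear.has_vector_derivative[OF bounded_linear_mult_right
            bounded_bilinear.has_vector_derivative[OF bounded_bilinear_inner nd]])
    then obtain k where "(\<kappa> has_vector_derivative k) (at 0)" by blast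
    then have k: "((\<lambda>t. \<kappa> t - \<kappa> 0) has_real_derivative k) (at 0)"
      by (auto simp: has_real_derivative_iff_has_vector_derivative intro!: derivative_eq_intros)
    have "((\<lambda>t. (\<kappa> t - \<kappa> 0) *\<^sub>R normal (\<gamma> t)) has_vector_derivative k *\<^sub>R normal u) (at 0)"
      using has_vector_derivative_scaleR[OF k nd] c(3) by simp
    moreover have "(\<kappa> t - \<kappa> 0) *\<^sub>R normal (\<gamma> t)
      = sgn (\<gamma> t - x) - sgn (z t - \<gamma> t) - (2 * (normal (\<gamma> 0) \<bullet> sgn (\<gamma> 0 - x))) *\<^sub>R normal (\<gamma> t)" if "t \<in> I" for t
      using sgn_bounce[OF x gI(1,2)[OF that]] by (simp add: z_def a_def \<kappa>_def reflect_def scaleR_diff_left)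
    ultimately have "((\<lambda>t. sgn (\<gamma> t - x) - sgn (z t - \<gamma> t) - (2 * (normal (\<gamma> 0) \<bullet> sgn (\<gamma> 0 - x))) *\<^sub>R normal (\<gamma> t))
       has_vector_derivative k *\<^sub>R normal u) (at 0)"
      by (rule has_vector_derivative_transform_within_open[OF _ I])
    then have "m = k *\<^sub>R normal u" using vector_derivative_unique_at m(1) by blast
    then have perp: "(\<zeta> - (b \<bullet> \<zeta>) *\<^sub>R b) \<bullet> w = 0" if "normal u \<bullet> w = 0" for w
      using m(2)[of w] that ker[OF that] c(3) zu by (simp add: b_def)
    define y where "y = \<zeta> - (b \<bullet> \<zeta>) *\<^sub>R b"
    have bb: "b \<bullet> b = 1" using zu by (simp add: b_def dot_square_norm norm_sgn)
    have yb: "y \<bullet> b = 0" by (simp add: y_def inner_diff_left inner_diff_right bb inner_commute)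
    (* y is orthogonal to all tangent vectors at u, hence normal; and it is orthogonal to b *)
    define r where "r = y - (normal u \<bullet> y) *\<^sub>R normal u"
    have nr: "normal u \<bullet> r = 0" using u by (simp add: r_def inner_diff_right normal_inner_normal)
    have "y \<bullet> r = 0" using perp[OF nr] by (simp add: y_def)
    then have "r \<bullet> r = 0" using nr by (simp add: r_def inner_diff_left)
    then have y: "y = (normal u \<bullet> y) *\<^sub>R normal u" by (simp add: r_def)
    have "0 < normal u \<bullet> b"
      using normal_pos[OF u(1) boundary_in_body[OF zS[OF I(2)]] zu] zu by (simp add: b_def sgn_div_norm)
    moreover have "(normal u \<bullet> y) * (normal u \<bullet> b) = 0" using yb y by (metis inner_scaleR_left)
    ultimately have "y = 0" using y by simp
    then have \<zeta>b: "\<zeta> = (b \<bullet> \<zeta>) *\<^sub>R b" by (simp add: y_def)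
    have "normal (z 0) \<bullet> \<zeta> = 0" using velocity_orthogonal_normal[OF I zS z] .
    moreover have "normal (z 0) \<bullet> b < 0"
      using normal_pos[OF zS[OF I(2)] boundary_in_body[OF u(1)]] zu
      by (simp add: b_def sgn_div_norm inner_diff_right mult_less_0_iff)
    ultimately have "b \<bullet> \<zeta> = 0" using \<zeta>b by (metis inner_scaleR_right less_irrefl mult_eq_0_iff)
    then show ?thesis using \<zeta>b by (simp add: \<zeta>_def)
  qed
  have "jacobi_field \<Sigma> (orbit x u) \<xi>"
    unfolding jacobi_field_def
  proof (intro conjI allI exI[of _ \<delta>] exI[of _ "\<lambda>t. orbit x (\<gamma> t)"] \<delta> ballI)
    show "\<xi> n \<in> tangent_space \<Sigma> (orbit x u n)" for n
      using velocity_in_tangent_space[OF \<delta>, of "\<lambda>t. orbit x (\<gamma> t) n"] onS \<xi> c(3) by (simp add: I_def abs_less_iff)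
    show "billiard_configuration \<Sigma> (orbit x (\<gamma> \<epsilon>))" if "\<epsilon> \<in> {-\<delta><..<\<delta>}" for \<epsilon>
      using billiard_configuration_orbit x gI that by (simp add: I_def)
  qed (use orb \<xi> c(3) in \<open>auto simp: I_def\<close>)
  then show ?thesis unfolding conjugate_points_def using \<xi>0 \<xi>1 \<xi>2 v(1) by (metis zero_less_numeral)
qed

text \<open>
  The first order condition leaves two possibilities for the outgoing direction: the reflected
  one, and the incoming one. In the second case \<open>u\<close> would lie between \<open>x\<close> and \<open>y\<close>, against strict
  convexity. For the second order condition, the boundary curves at hand are only \<open>C\<^sup>1\<close>, so length
  need not have a second derivative along them. Its first derivative is, however, the inner
  product of the velocity with the vector of \<open>first_variation_derivative\<close>; a positive value of the
  Hessian would make it positive for all small positive times.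
\<close>

lemma length_maximizer:
  assumes x: "x \<in> \<Sigma>" and y: "y \<in> \<Sigma>" "x \<noteq> y" and u: "u \<in> \<Sigma>" "x \<noteq> u" "y \<noteq> u"
    and mx: "\<And>p. p \<in> \<Sigma> \<Longrightarrow> dist x p + dist p y \<le> dist x u + dist u y"
  shows "bounce x u = y" and "normal u \<bullet> v = 0 \<Longrightarrow> length_hessian x u v v \<le> 0"
proof -
  define a b where "a = sgn (u - x)" "b = sgn (y - u)"
  have ab1: "a \<bullet> a = 1" "b \<bullet> b = 1" using u by (simp_all add: a_b_def dot_square_norm norm_sgn)
  have der: "((\<lambda>t. dist x (\<gamma> t) + dist (\<gamma> t) y) has_real_derivative (sgn (\<gamma> t - x) - sgn (y - \<gamma> t)) \<bullet> v) (at t)"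
    if "(\<gamma> has_vector_derivative v) (at t)" "x \<noteq> \<gamma> t" "\<gamma> t \<noteq> y" for \<gamma> t v
    using DERIV_add[OF has_vector_derivative_dist[OF has_vector_derivative_const that(1,2)]
        has_vector_derivative_dist[OF that(1) has_vector_derivative_const that(3)]]
    by (simp add: inner_diff_left)
  have crit: "(a - b) \<bullet> v = 0" if v: "normal u \<bullet> v = 0" for v
  proof -
    obtain \<delta> \<gamma> \<gamma>' where c: "\<delta> > 0" "\<And>t. \<bar>t\<bar> < \<delta> \<Longrightarrow> \<gamma> t \<in> \<Sigma>" "\<gamma> 0 = u" "\<gamma>' 0 = v"
      "\<And>t. \<bar>t\<bar> < \<delta> \<Longrightarrow> (\<gamma> has_vector_derivative \<gamma>' t) (at t)"
      by (rule curve_with_velocity[OF u(1) v]) blast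
    have "((\<lambda>t. dist x (\<gamma> t) + dist (\<gamma> t) y) has_real_derivative (a - b) \<bullet> v) (at 0)"
      using der[OF c(5)[of 0]] c(1,3,4) u by (simp add: a_b_def)
    then show ?thesis by (rule DERIV_local_max[OF _ c(1)]) (use c(2,3) mx in auto)
  qed
  define k where "k = normal u \<bullet> (a - b)"
  define r where "r = (a - b) - k *\<^sub>R normal u"
  have nr: "normal u \<bullet> r = 0" using u by (simp add: r_def k_def inner_diff_right normal_inner_normal)
  have "r \<bullet> r = 0" using crit[OF nr] nr by (simp add: r_def inner_diff_left)
  then have "r = 0" by simp
  then have bk: "b = a - k *\<^sub>R normal u" by (simp add: r_def algebra_simps)
  have "b \<bullet> b = a \<bullet> a - 2 * k * (normal u \<bullet> a) + k * k"
    using u by (simp add: bk inner_diff_left inner_diff_right normal_inner_normal inner_commute algebra_simps)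
  then have "k * k = 2 * k * (normal u \<bullet> a)" using ab1 by linarith
  then have "k * k = k * (2 * (normal u \<bullet> a))" by (simp only: ac_simps)
  moreover have "k \<noteq> 0"
  proof
    assume "k = 0"
    then have "a = b" using bk by simp
    then have "(u - x) /\<^sub>R norm (u - x) = (y - u) /\<^sub>R norm (y - u)" by (simp add: a_b_def sgn_div_norm)
    then have "normal u \<bullet> ((u - x) /\<^sub>R norm (u - x)) = normal u \<bullet> ((y - u) /\<^sub>R norm (y - u))" by simp
    moreover have "normal u \<bullet> ((u - x) /\<^sub>R norm (u - x)) < 0"
      using normal_pos[OF u(1) boundary_in_body[OF x] u(2)] u by (simp add: inner_diff_right mult_less_0_iff)
    moreover have "0 < normal u \<bullet> ((y - u) /\<^sub>R norm (y - u))"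
      using normal_pos[OF u(1) boundary_in_body[OF y(1)] u(3)] u by simp
    ultimately show False by simp
  qed
  ultimately have k: "k = 2 * (normal u \<bullet> a)" using mult_left_cancel by blast
  show bnc: "bounce x u = y"
    by (rule bounce_eqI_sgn) (use x y u bk k in \<open>auto simp: a_b_def reflect_def\<close>)
  assume v: "normal u \<bullet> v = 0"
  show "length_hessian x u v v \<le> 0"
  proof (rule ccontr)
    assume "\<not> ?thesis"
    then have pos: "length_hessian x u v v > 0" by simp
    obtain \<delta> \<gamma> \<gamma>' where c: "\<delta> > 0" "\<And>t. \<bar>t\<bar> < \<delta> \<Longrightarrow> \<gamma> t \<in> \<Sigma>" "\<gamma> 0 = u" "\<gamma>' 0 = v"
      "\<And>t. \<bar>t\<bar> < \<delta> \<Longrightarrow> (\<gamma> has_vector_derivative \<gamma>' t) (at t)" "continuous_on {-\<delta><..<\<delta>} \<gamma>'"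
      by (rule curve_with_velocity[OF u(1) v]) blast
    define I where "I = {-\<delta><..<\<delta>}"
    have I: "open I" "0 \<in> I" "\<And>t. t \<in> I \<Longrightarrow> \<bar>t\<bar> < \<delta>" using c(1) by (auto simp: I_def)
    define M where "M t = sgn (\<gamma> t - x) - sgn (y - \<gamma> t) - (2 * (normal (\<gamma> 0) \<bullet> sgn (\<gamma> 0 - x))) *\<^sub>R normal (\<gamma> t)" for t
    obtain m where m: "(M has_vector_derivative m) (at 0)"
      "\<And>w. normal (\<gamma> 0) \<bullet> w = 0 \<Longrightarrow> m \<bullet> w = length_hessian x (\<gamma> 0) v w
       - (0 - (sgn (y - \<gamma> 0) \<bullet> 0) *\<^sub>R sgn (y - \<gamma> 0)) \<bullet> w / norm (y - \<gamma> 0)"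
    proof (rule first_variation_derivative[OF x I(1,2), of \<gamma> v "\<lambda>_. y" 0])
      show "(\<gamma> has_vector_derivative v) (at 0)" using c(1,4) c(5)[of 0] by simp
    qed (use c I u bnc in \<open>auto simp: M_def[abs_def]\<close>)
    have mv: "m \<bullet> v = length_hessian x u v v" using m(2)[of v] v c(3) by simp
    have M0: "M 0 = 0" using bk k by (simp add: M_def c(3) a_b_def)
    have cont: "isCont \<gamma> 0" "isCont \<gamma>' 0"
      using c(1) c(5)[of 0] c(6) I by (auto simp: has_vector_derivative_continuous continuous_on_eq_continuous_at I_def)
    have "((\<lambda>t. (M t - M 0) /\<^sub>R t) \<longlongrightarrow> m) (at 0)"
      using m(1) by (rule has_vector_derivative_quotient_tendsto)
    then have "((\<lambda>t. ((M t - M 0) /\<^sub>R t) \<bullet> \<gamma>' t) \<longlongrightarrow> m \<bullet> v) (at 0)"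
      using cont(2) c(4) by (intro tendsto_inner) (auto simp: isCont_def)
    then have "eventually (\<lambda>t. 0 < ((M t - M 0) /\<^sub>R t) \<bullet> \<gamma>' t) (at 0)"
      using pos mv by (intro order_tendstoD) auto
    moreover have "eventually (\<lambda>t. \<gamma> t \<noteq> x) (at 0)" "eventually (\<lambda>t. \<gamma> t \<noteq> y) (at 0)"
      by (rule tendsto_imp_eventually_ne[OF cont(1)[unfolded isCont_def c(3)]], use u in metis)+
    moreover have "eventually (\<lambda>t. t \<in> I) (at 0)" using I(1,2) by (rule eventually_at_in_open')
    ultimately have "eventually (\<lambda>t. 0 < ((M t - M 0) /\<^sub>R t) \<bullet> \<gamma>' t \<and> \<gamma> t \<noteq> x \<and> \<gamma> t \<noteq> y \<and> t \<in> I) (at 0)"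
      by (intro eventually_conj)
    then obtain d where d: "d > 0" "\<And>t. t \<noteq> 0 \<Longrightarrow> \<bar>t\<bar> < d \<Longrightarrow> 0 < ((M t - M 0) /\<^sub>R t) \<bullet> \<gamma>' t \<and> \<gamma> t \<noteq> x \<and> \<gamma> t \<noteq> y \<and> t \<in> I"
      by (auto simp: eventually_at)
    define \<phi> where "\<phi> t = dist x (\<gamma> t) + dist (\<gamma> t) y" for t
    have \<phi>: "(\<phi> has_real_derivative (M t \<bullet> \<gamma>' t)) (at t)" if t: "\<bar>t\<bar> < d" for t
    proof -
      have tt: "t \<in> I" "x \<noteq> \<gamma> t" "\<gamma> t \<noteq> y" using d(2)[OF _ t] u c(3) I(2) by (cases "t = 0"; auto)+
      have g: "(\<gamma> has_vector_derivative \<gamma>' t) (at t)" using c(5) I(3) tt by blast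
      have "normal (\<gamma> t) \<bullet> \<gamma>' t = 0"
        using velocity_orthogonal_normal[OF I(1) tt(1) _ g] c(2) I(3) by blast
      then show ?thesis using der[OF g tt(2,3)] unfolding \<phi>_def M_def by (simp add: inner_diff_left)
    qed
    have "\<phi> 0 < \<phi> (d/2)"
    proof (rule DERIV_pos_imp_increasing_open[of 0 "d/2" \<phi>])
      fix t assume t: "0 < t" "t < d / 2"
      then have "0 < (M t /\<^sub>R t) \<bullet> \<gamma>' t" using d(2)[of t] M0 by simp
      then have "0 < M t \<bullet> \<gamma>' t" using t by (simp add: zero_less_mult_iff)
      then show "\<exists>y. (\<phi> has_real_derivative y) (at t) \<and> 0 < y" using \<phi>[of t] t by auto
    next
      show "continuous_on {0..d/2} \<phi>"
      proof (intro continuous_at_imp_continuous_on ballI)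
        fix t assume "t \<in> {0..d/2}"
        then have "\<bar>t\<bar> < d" using d(1) by auto
        then show "isCont \<phi> t" by (rule DERIV_isCont[OF \<phi>])
      qed
    qed (use d(1) in auto)
    moreover have "\<phi> (d/2) \<le> \<phi> 0"
    proof -
      have "d/2 \<in> I" using d(2)[of "d/2"] d(1) by simp
      then have "\<gamma> (d/2) \<in> \<Sigma>" using c(2) I(3) by blast
      then show ?thesis using mx c(3) by (simp add: \<phi>_def)
    qed
    ultimately show False by simp
  qed
qed

section \<open>Semidefiniteness and openness\<close>

lemma linear_normal_deriv: "u \<in> \<Sigma> \<Longrightarrow> linear (normal_deriv u)"
  using has_derivative_normal has_derivative_linear by blast

lemma length_hessian_expand:
  assumes u: "u \<in> \<Sigma>" and t: "normal u \<bullet> v = 0" "normal u \<bullet> w = 0"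
  shows "length_hessian x u (v + c *\<^sub>R w) (v + c *\<^sub>R w)
     = length_hessian x u v v + 2 * c * length_hessian x u v w + c\<^sup>2 * length_hessian x u w w"
proof -
  have sym: "normal_deriv u w \<bullet> v = normal_deriv u v \<bullet> w" using normal_deriv_symmetric[OF u t(2,1)] .
  have lin: "normal_deriv u (v + c *\<^sub>R w) = normal_deriv u v + c *\<^sub>R normal_deriv u w"
    using linear_normal_deriv[OF u] by (simp add: linear_add linear_scale)
  have wv: "w \<bullet> v = v \<bullet> w" by (rule inner_commute)
  show ?thesis
    unfolding length_hessian_def lin inner_add_left inner_add_right inner_scaleR_left inner_scaleR_right sym wv
    by (simp add: algebra_simps power2_eq_square)
qed

lemma length_hessian_scaleR:
  assumes "u \<in> \<Sigma>"
  shows "length_hessian x u (c *\<^sub>R v) (c *\<^sub>R v) = c\<^sup>2 * length_hessian x u v v"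
  using linear_normal_deriv[OF assms]
  by (simp add: length_hessian_def linear_scale algebra_simps power2_eq_square)

text \<open>
  If \<open>v\<close> is a null vector and \<open>H(v, w) \<noteq> 0\<close>, then \<open>v + c w\<close> with small \<open>c\<close> of the sign of
  \<open>H(v, w)\<close> makes the form positive.
\<close>

lemma semidefinite_kernel:
  assumes u: "u \<in> \<Sigma>" and le: "\<And>v. normal u \<bullet> v = 0 \<Longrightarrow> length_hessian x u v v \<le> 0"
    and v: "normal u \<bullet> v = 0" "length_hessian x u v v = 0" and w: "normal u \<bullet> w = 0"
  shows "length_hessian x u v w = 0"
proof (rule ccontr)
  define c d where "c = length_hessian x u v w" "d = length_hessian x u w w"
  assume "length_hessian x u v w \<noteq> 0"
  then have c: "c \<noteq> 0" by (simp add: c_d_def)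
  define s where "s = 1 / (\<bar>d\<bar> + 1)"
  have s: "s > 0" by (simp add: s_def add_nonneg_pos)
  have "s * \<bar>d\<bar> \<le> 1" by (simp add: s_def field_simps)
  moreover have "\<bar>s * d\<bar> = s * \<bar>d\<bar>" using s by (simp add: abs_mult)
  ultimately have sd: "2 + s * d > 0" by linarith
  have "normal u \<bullet> (v + (s * c) *\<^sub>R w) = 0" using v w by (simp add: inner_add_right)
  from le[OF this] have "2 * (s * c) * c + (s * c)\<^sup>2 * d \<le> 0"
    using length_hessian_expand[OF u v(1) w, of x "s * c"] v(2) by (simp add: c_d_def)
  moreover have "2 * (s * c) * c + (s * c)\<^sup>2 * d = s * c\<^sup>2 * (2 + s * d)"
    by (simp add: algebra_simps power2_eq_square)
  moreover have "s * c\<^sup>2 * (2 + s * d) > 0" using s c sd by simp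
  ultimately show False by linarith
qed

lemma continuous_on_bounce:
  assumes x: "x \<in> \<Sigma>"
  shows "continuous_on (\<Sigma> - {x}) (bounce x)"
  unfolding continuous_on_eq_continuous_within
proof
  fix u assume u: "u \<in> \<Sigma> - {x}"
  define w where "w p = reflect p (p - x)" for p
  have uS: "u \<in> \<Sigma>" "x \<noteq> u" using u by auto
  obtain a where a: "a > 0" "bounce x u = u + a *\<^sub>R w u" "bounce x u \<in> \<Sigma>"
    using bounce_ray[OF x uS] by (auto simp: w_def)
  have nz: "normal (u + a *\<^sub>R w u) \<bullet> w u \<noteq> 0"
  proof -
    have "0 < normal (bounce x u) \<bullet> (u - bounce x u)"
      using normal_pos[OF a(3) boundary_in_body[OF uS(1)]] bounce_neq[OF x uS] by metis
    then show ?thesis using a by auto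
  qed
  obtain V \<tau> where V: "open V" "(u, w u) \<in> V" "\<tau> (u, w u) = a"
    "\<And>x. x \<in> V \<Longrightarrow> fst x + \<tau> x *\<^sub>R snd x \<in> \<Sigma>"
    "\<And>x. x \<in> V \<Longrightarrow> (\<tau> has_derivative (\<lambda>d. - (normal (fst x + \<tau> x *\<^sub>R snd x) \<bullet> (fst d + \<tau> x *\<^sub>R snd d))
        / (normal (fst x + \<tau> x *\<^sub>R snd x) \<bullet> snd x))) (at x)"
    by (rule boundary_hit[OF a(3)[unfolded a(2)] nz]) blast
  let ?F = "at u within (\<Sigma> - {x})"
  have "continuous_on (\<Sigma> - {x}) w" unfolding w_def reflect_def
    by (intro continuous_intros continuous_on_subset[OF continuous_on_normal]) auto
  then have w: "(w \<longlongrightarrow> w u) ?F" using u by (simp add: continuous_on_def)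
  have F: "((\<lambda>p. (p, w p)) \<longlongrightarrow> (u, w u)) ?F" by (intro tendsto_Pair w tendsto_ident_at)
  have "isCont \<tau> (u, w u)" using V(5)[OF V(2)] by (rule has_derivative_continuous)
  then have \<tau>: "((\<lambda>p. \<tau> (p, w p)) \<longlongrightarrow> a) ?F" using isCont_tendsto_compose[OF _ F] V(3) by force
  have "eventually (\<lambda>p. (p, w p) \<in> V) ?F" using topological_tendstoD[OF F V(1,2)] .
  moreover have "eventually (\<lambda>p. 0 < \<tau> (p, w p)) ?F" using order_tendstoD(1)[OF \<tau> a(1)] .
  moreover have "eventually (\<lambda>p. p \<in> \<Sigma> - {x}) ?F" by (simp add: eventually_at_filter)
  ultimately have "eventually (\<lambda>p. p + \<tau> (p, w p) *\<^sub>R w p = bounce x p) ?F"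
  proof eventually_elim
    case (elim p)
    then show ?case using bounce_eqI[OF x, of p "\<tau> (p, w p)"] V(4)[of "(p, w p)"] by (auto simp: w_def)
  qed
  moreover have "((\<lambda>p. p + \<tau> (p, w p) *\<^sub>R w p) \<longlongrightarrow> u + a *\<^sub>R w u) ?F"
    by (intro tendsto_intros \<tau> w)
  ultimately show "continuous ?F (bounce x)"
    unfolding continuous_within a(2) by (rule Lim_transform_eventually[rotated])
qed

text \<open>
  The Hessian is meaningful on tangent vectors only. Near \<open>u\<close> it extends to a function that is
  jointly continuous in the base point and an arbitrary vector.
\<close>

lemma length_hessian_local:
  assumes x: "x \<in> \<Sigma>" and u: "u \<in> \<Sigma>" "u \<noteq> x"
  obtains U q where "open U" "u \<in> U" "continuous_on (((\<Sigma> - {x}) \<inter> U) \<times> UNIV) q"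
    "\<And>p v. p \<in> (\<Sigma> - {x}) \<inter> U \<Longrightarrow> normal p \<bullet> v = 0 \<Longrightarrow> q (p, v) = length_hessian x p v v"
proof -
  obtain U N' where U: "open U" "u \<in> U" "continuous_on U N'"
    "\<And>q v. q \<in> U \<Longrightarrow> q \<in> \<Sigma> \<Longrightarrow> normal q \<bullet> v = 0 \<Longrightarrow> normal_deriv q v = blinfun_apply (N' q :: 'a \<Rightarrow>\<^sub>L 'a) v"
    by (rule normal_deriv_local[OF u(1)]) blast
  define q where "q y = (case y of (p, v) \<Rightarrow>
     (1 / norm (p - x) + 1 / norm (bounce x p - p)) * (v \<bullet> v - (sgn (p - x) \<bullet> v) * (sgn (p - x) \<bullet> v))
     - 2 * (normal p \<bullet> sgn (p - x)) * (blinfun_apply (N' p) v \<bullet> v))" for y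
  let ?A = "((\<Sigma> - {x}) \<inter> U) \<times> (UNIV :: 'a set)"
  have ne: "bounce x p \<noteq> p" if "p \<in> \<Sigma>" "p \<noteq> x" for p using bounce_neq[OF x] that by blast
  have 1: "continuous_on ?A (\<lambda>y. bounce x (fst y))"
    by (rule continuous_on_compose2[OF continuous_on_bounce[OF x]]) (auto intro!: continuous_intros)
  have 2: "continuous_on ?A (\<lambda>y. normal (fst y))"
    by (rule continuous_on_compose2[OF continuous_on_normal]) (auto intro!: continuous_intros)
  have 3: "continuous_on ?A (\<lambda>y. N' (fst y))"
    by (rule continuous_on_compose2[OF U(3)]) (auto intro!: continuous_intros)
  have 4: "continuous_on ?A (\<lambda>y. sgn (fst y - x))"
    unfolding sgn_div_norm by (intro continuous_intros) auto
  have "continuous_on ?A q"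
    unfolding q_def case_prod_unfold
    by (intro continuous_intros 1 2 3 4) (auto simp: ne)
  moreover have "q (p, v) = length_hessian x p v v" if "p \<in> (\<Sigma> - {x}) \<inter> U" "normal p \<bullet> v = 0" for p v
    using U(4)[of p v] that by (simp add: q_def length_hessian_def)
  ultimately show ?thesis using that[of U q] U(1,2) by blast
qed

text \<open>
  A positive tangent vector at one point is projected to the tangent spaces at the neighbouring
  points.
\<close>

lemma openin_positive_direction:
  assumes x: "x \<in> \<Sigma>"
  shows "openin (top_of_set (\<Sigma> - {x})) {u \<in> \<Sigma> - {x}. \<exists>v. normal u \<bullet> v = 0 \<and> length_hessian x u v v > 0}"
    (is "openin _ ?P")
proof (subst openin_subopen, intro ballI)
  fix u assume u: "u \<in> ?P"
  then obtain v where v: "normal u \<bullet> v = 0" "length_hessian x u v v > 0" by blast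
  obtain U q where U: "open U" "u \<in> U" "continuous_on (((\<Sigma> - {x}) \<inter> U) \<times> UNIV) q"
    "\<And>p v. p \<in> (\<Sigma> - {x}) \<inter> U \<Longrightarrow> normal p \<bullet> v = 0 \<Longrightarrow> q (p, v) = length_hessian x p v v"
    using length_hessian_local[OF x] u by blast
  define T where "T = (\<Sigma> - {x}) \<inter> U"
  define V where "V p = v - (normal p \<bullet> v) *\<^sub>R normal p" for p
  have V: "normal p \<bullet> V p = 0" if "p \<in> \<Sigma>" for p
    using that by (simp add: V_def inner_diff_right normal_inner_normal)
  have "continuous_on T V"
    unfolding V_def by (intro continuous_intros continuous_on_subset[OF continuous_on_normal]) (auto simp: T_def)
  then have "continuous_on T (\<lambda>p. q (p, V p))"
    by (intro continuous_on_compose2[OF U(3)] continuous_intros) (auto simp: T_def)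
  then have "openin (top_of_set T) (T \<inter> (\<lambda>p. q (p, V p)) -` {0<..})"
    by (intro continuous_openin_preimage_gen) auto
  moreover have "openin (top_of_set (\<Sigma> - {x})) T" unfolding T_def using U(1) by blast
  ultimately have "openin (top_of_set (\<Sigma> - {x})) (T \<inter> (\<lambda>p. q (p, V p)) -` {0<..})"
    by (rule openin_trans)
  moreover have "u \<in> T \<inter> (\<lambda>p. q (p, V p)) -` {0<..}"
    using u v U(2,4) by (auto simp: T_def V_def)
  moreover have "T \<inter> (\<lambda>p. q (p, V p)) -` {0<..} \<subseteq> ?P"
  proof
    fix p assume p: "p \<in> T \<inter> (\<lambda>p. q (p, V p)) -` {0<..}"
    then have "length_hessian x p (V p) (V p) > 0" using U(4)[of p "V p"] V[of p] by (simp add: T_def)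
    then show "p \<in> ?P" using p V[of p] by (auto simp: T_def)
  qed
  ultimately show "\<exists>T. openin (top_of_set (\<Sigma> - {x})) T \<and> u \<in> T \<and> T \<subseteq> ?P" by blast
qed

text \<open>
  The function \<open>r\<close> below extends the form from tangent vectors to all vectors, subtracting the
  square of the normal component, so that it is negative on the whole unit sphere; compactness of
  the sphere keeps it negative nearby.
\<close>

lemma openin_negative_definite:
  assumes x: "x \<in> \<Sigma>"
  shows "openin (top_of_set (\<Sigma> - {x})) {u \<in> \<Sigma> - {x}. \<forall>v. v \<noteq> 0 \<and> normal u \<bullet> v = 0 \<longrightarrow> length_hessian x u v v < 0}"
    (is "openin _ ?P")
proof (subst openin_subopen, intro ballI)
  fix u assume u: "u \<in> ?P"
  obtain U q where U: "open U" "u \<in> U" "continuous_on (((\<Sigma> - {x}) \<inter> U) \<times> UNIV) q"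
    "\<And>p v. p \<in> (\<Sigma> - {x}) \<inter> U \<Longrightarrow> normal p \<bullet> v = 0 \<Longrightarrow> q (p, v) = length_hessian x p v v"
    using length_hessian_local[OF x] u by blast
  define T where "T = (\<Sigma> - {x}) \<inter> U"
  define P where "P p v = v - (normal p \<bullet> v) *\<^sub>R normal p" for p v
  define r where "r y = (case y of (p, v) \<Rightarrow> q (p, P p v) - (normal p \<bullet> v)\<^sup>2)" for y
  let ?S = "sphere 0 1 :: 'a set"
  have n: "continuous_on (T \<times> ?S) (\<lambda>y. normal (fst y))"
    by (rule continuous_on_compose2[OF continuous_on_normal]) (auto intro!: continuous_intros simp: T_def)
  have "continuous_on (T \<times> ?S) (\<lambda>y. q (fst y, P (fst y) (snd y)))"
    by (rule continuous_on_compose2[OF U(3)]) (auto simp: T_def P_def intro!: continuous_intros n[unfolded T_def])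
  then have r: "continuous_on (T \<times> ?S) r"
    unfolding r_def case_prod_unfold by (intro continuous_intros n)
  have uT: "u \<in> T" using u U(2) by (simp add: T_def)
  have Pn: "normal p \<bullet> P p v = 0" if "p \<in> T" for p v
    using that by (simp add: T_def P_def inner_diff_right normal_inner_normal)
  have neg: "r (u, v) < 0" if "v \<in> ?S" for v
  proof (cases "P u v = 0")
    case True
    then have "v = (normal u \<bullet> v) *\<^sub>R normal u" by (simp add: P_def)
    then have "normal u \<bullet> v \<noteq> 0" using that by auto
    moreover have "q (u, P u v) = 0" using U(4)[of u 0] uT True by (simp add: T_def length_hessian_def)
    ultimately show ?thesis by (simp add: r_def)
  next
    case False
    then have "q (u, P u v) < 0" using u Pn[OF uT] U(4)[of u "P u v"] uT by (simp add: T_def)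
    then show ?thesis by (simp add: r_def) (smt (verit) zero_le_power2)
  qed
  have "?S \<noteq> {}" by simp
  moreover have "continuous_on ?S (\<lambda>v. r (u, v))"
    by (rule continuous_on_compose2[OF r]) (use uT in \<open>auto intro!: continuous_intros\<close>)
  ultimately obtain v0 where v0: "v0 \<in> ?S" "\<And>v. v \<in> ?S \<Longrightarrow> r (u, v) \<le> r (u, v0)"
    using continuous_attains_sup[OF compact_sphere] by metis
  define e where "e = - r (u, v0) / 2"
  have e: "e > 0" using neg[OF v0(1)] by (simp add: e_def)
  obtain X where X: "u \<in> X" "open X" "\<forall>p\<in>X \<inter> T. \<forall>v\<in>?S. dist (r (p, v)) (r (u, v)) \<le> e"
    using continuous_on_prod_compactE[OF r compact_sphere uT e] by metis
  have "openin (top_of_set (\<Sigma> - {x})) ((\<Sigma> - {x}) \<inter> (U \<inter> X))" using U(1) X(2) by blast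
  moreover have "(\<Sigma> - {x}) \<inter> (U \<inter> X) \<subseteq> ?P"
  proof clarify
    fix p assume p: "p \<in> \<Sigma>" "p \<in> U" "p \<in> X"
    assume px: "p \<notin> {}" "p \<noteq> x"
    show "p \<in> \<Sigma> - {x} \<and> (\<forall>v. v \<noteq> 0 \<and> normal p \<bullet> v = 0 \<longrightarrow> length_hessian x p v v < 0)"
    proof (intro conjI allI impI)
      fix v assume v: "v \<noteq> 0 \<and> normal p \<bullet> v = 0"
      have pT: "p \<in> T" using p px by (simp add: T_def)
      have sv: "sgn v \<in> ?S" using v by (simp add: norm_sgn)
      have nsv: "normal p \<bullet> sgn v = 0" using v by (simp add: sgn_div_norm)
      have "dist (r (p, sgn v)) (r (u, sgn v)) \<le> e" using X(3) p(3) pT sv by blast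
      then have "r (p, sgn v) \<le> r (u, sgn v) + e" unfolding dist_real_def by linarith
      also have "\<dots> \<le> r (u, v0) + e" using v0(2)[OF sv] by simp
      also have "\<dots> < 0" using e by (simp add: e_def)
      finally have "length_hessian x p (sgn v) (sgn v) < 0"
        using U(4)[of p "sgn v"] pT nsv by (simp add: r_def P_def T_def)
      moreover have "length_hessian x p v v = (norm v)\<^sup>2 * length_hessian x p (sgn v) (sgn v)"
        using length_hessian_scaleR[OF p(1), of x "norm v" "sgn v"] v by (simp add: sgn_div_norm)
      ultimately show "length_hessian x p v v < 0" using v by (simp add: mult_less_0_iff)
    qed (use p px in auto)
  qed
  ultimately show "\<exists>T. openin (top_of_set (\<Sigma> - {x})) T \<and> u \<in> T \<and> T \<subseteq> ?P"
    using u U(2) X(1) by (intro exI[of _ "(\<Sigma> - {x}) \<inter> (U \<inter> X)"]) auto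
qed

section \<open>Conjugate points along infinitely many trajectories\<close>

lemma punctured_boundary_homeomorphic_hyperplane:
  fixes c :: 'a
  assumes x: "x \<in> \<Sigma>" and c: "c \<noteq> 0"
  shows "\<Sigma> - {x} homeomorphic {y. c \<bullet> y = 0}"
proof -
  have "rel_frontier K = \<Sigma>" using rel_frontier_nonempty_interior body(3) by blast
  moreover have "aff_dim K = DIM('a)" using body(3) aff_dim_nonempty_interior by blast
  ultimately show ?thesis
    using homeomorphic_punctured_sphere_affine_gen[OF body(2,5), of x "{y. c \<bullet> y = 0}"] x c
    by (simp add: affine_hyperplane aff_dim_hyperplane)
qed

text \<open>
  Otherwise the boundary without \<open>x\<close> would be compact, but it is homeomorphic to a hyperplane.
\<close>

lemma boundary_islimpt:
  assumes x: "x \<in> \<Sigma>" and dim: "DIM('a) \<ge> 2"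
  shows "x islimpt \<Sigma>"
proof (rule ccontr)
  assume "\<not> x islimpt \<Sigma>"
  then obtain U where U: "open U" "x \<in> U" "\<And>y. y \<in> \<Sigma> \<Longrightarrow> y \<in> U \<Longrightarrow> y = x"
    unfolding islimpt_def by blast
  then have "\<Sigma> - {x} = \<Sigma> - U" using x by blast
  then have "compact (\<Sigma> - {x})" using compact_diff[OF compact_boundary U(1)] by simp
  moreover obtain c :: 'a where "c \<in> Basis" using nonempty_Basis by blast
  then have c: "c \<noteq> 0" by (rule nonzero_Basis)
  ultimately have "compact {y. c \<bullet> y = 0}"
    using punctured_boundary_homeomorphic_hyperplane[OF x c] homeomorphic_compactness by blast
  then have "bounded {y. c \<bullet> y = 0}" by (rule compact_imp_bounded)
  then show False using bounded_hyperplane_eq_trivial[of c 0] c dim by simp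
qed

lemma connected_boundary_diff_finite:
  assumes x: "x \<in> \<Sigma>" and dim: "DIM('a) > 2" and D: "finite D"
  shows "connected (\<Sigma> - {x} - D)"
proof -
  obtain c :: 'a where "c \<in> Basis" using nonempty_Basis by blast
  then have c: "c \<noteq> 0" by (rule nonzero_Basis)
  let ?H = "{y. c \<bullet> y = 0}"
  obtain g h where gh: "homeomorphism (\<Sigma> - {x}) ?H g h"
    using punctured_boundary_homeomorphic_hyperplane[OF x c] unfolding homeomorphic_def by blast
  have "\<not> collinear ?H" using aff_dim_hyperplane[OF c, of 0] dim by (simp add: collinear_aff_dim)
  moreover have "affine hull ?H = ?H" by (simp add: affine_hull_eq affine_hyperplane)
  then have "openin (top_of_set (affine hull ?H)) ?H" by (simp only: openin_subtopology_self)
  moreover have "connected ?H" by (intro convex_connected convex_hyperplane)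
  ultimately have "connected (?H - g ` (D \<inter> (\<Sigma> - {x})))"
    using D by (intro connected_openin_diff_countable countable_finite finite_imageI finite_Int) auto
  moreover have "continuous_on (?H - g ` (D \<inter> (\<Sigma> - {x}))) h"
    by (rule continuous_on_subset[OF homeomorphism_cont2[OF gh]]) blast
  ultimately have "connected (h ` (?H - g ` (D \<inter> (\<Sigma> - {x}))))" by (intro connected_continuous_image)
  moreover have "h ` (?H - g ` (D \<inter> (\<Sigma> - {x}))) = \<Sigma> - {x} - D"
  proof -
    have "inj_on h ?H" by (rule inj_on_inverseI[where g=g]) (rule homeomorphism_apply2[OF gh])
    then have "h ` (?H - g ` (D \<inter> (\<Sigma> - {x}))) = h ` ?H - h ` g ` (D \<inter> (\<Sigma> - {x}))"
      by (rule inj_on_image_set_diff) (use homeomorphism_image1[OF gh] in blast)+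
    moreover have "h ` g ` (D \<inter> (\<Sigma> - {x})) = D \<inter> (\<Sigma> - {x})"
      unfolding image_image by (simp add: homeomorphism_apply1[OF gh])
    ultimately show ?thesis using homeomorphism_image2[OF gh] by auto
  qed
  ultimately show ?thesis by simp
qed

text \<open>
  On a tangent vector orthogonal to the chord the Hessian is at least \<open>1 / |u - x|\<close> minus a bound
  for twice the derivative of the normal, for a unit vector. The latter is bounded near \<open>x\<close>, while
  the former tends to infinity.
\<close>

lemma positive_direction_exists:
  assumes x: "x \<in> \<Sigma>" and dim: "DIM('a) > 2"
  shows "\<exists>u\<in>\<Sigma> - {x}. \<exists>v. normal u \<bullet> v = 0 \<and> length_hessian x u v v > 0"
proof -
  obtain U N' where U: "open U" "x \<in> U" "continuous_on U N'"
    "\<And>q v. q \<in> U \<Longrightarrow> q \<in> \<Sigma> \<Longrightarrow> normal q \<bullet> v = 0 \<Longrightarrow> normal_deriv q v = blinfun_apply (N' q :: 'a \<Rightarrow>\<^sub>L 'a) v"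
    by (rule normal_deriv_local[OF x]) blast
  define C where "C = norm (N' x) + 1"
  have C: "C > 0" by (simp add: C_def add_nonneg_pos)
  have "isCont N' x" using U by (simp add: continuous_on_eq_continuous_at)
  then have "eventually (\<lambda>u. norm (N' u) < C) (at x)"
    by (intro order_tendstoD(2)[of _ "norm (N' x)"] tendsto_norm) (auto simp: isCont_def C_def)
  moreover have "eventually (\<lambda>u. u \<in> U) (at x)" using U by (intro eventually_at_in_open')
  moreover have "eventually (\<lambda>u. u \<in> ball x (1 / (2 * C))) (at x)" using C by (intro eventually_at_in_open') auto
  ultimately have "eventually (\<lambda>u. norm (N' u) < C \<and> u \<in> U \<and> u \<in> ball x (1 / (2 * C))) (at x)"
    by (intro eventually_conj)
  then obtain W where W: "open W" "x \<in> W" "\<And>u. u \<in> W \<Longrightarrow> u \<noteq> x \<Longrightarrow> norm (N' u) < C \<and> u \<in> U \<and> u \<in> ball x (1 / (2 * C))"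
    by (auto simp: eventually_at_topological)
  obtain u where u: "u \<in> \<Sigma>" "u \<noteq> x" "u \<in> W"
    using boundary_islimpt[OF x] dim W(1,2) unfolding islimpt_def by auto
  define a where "a = sgn (u - x)"
  have "dim {normal u, a} < DIM('a)"
    using dim_le_card'[of "{normal u, a}"] card_insert_le_m1[of 2 "{a}" "normal u"] dim by auto
  then obtain v where v: "v \<noteq> 0" "\<And>y. y \<in> span {normal u, a} \<Longrightarrow> orthogonal v y"
    using orthogonal_to_subspace_exists by blast
  have nv: "normal u \<bullet> v = 0" and av: "a \<bullet> v = 0"
    using v(2)[of "normal u"] v(2)[of a] by (auto simp: orthogonal_def span_base inner_commute)
  have l: "norm (u - x) < 1 / (2 * C)" "norm (N' u) < C" "u \<in> U" "norm (u - x) > 0"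
    using W(3)[OF u(3,2)] u(2) by (auto simp: dist_norm norm_minus_commute)
  have "2 * C < 1 / norm (u - x)" using l C by (simp add: field_simps)
  also have "\<dots> \<le> 1 / norm (u - x) + 1 / norm (bounce x u - u)" by simp
  finally have big: "2 * C < 1 / norm (u - x) + 1 / norm (bounce x u - u)" .
  have "\<bar>normal u \<bullet> a\<bar> \<le> 1"
    using Cauchy_Schwarz_ineq2[of "normal u" a] norm_normal[OF u(1)] u(2) by (simp add: a_def norm_sgn)
  moreover have "\<bar>N' u v \<bullet> v\<bar> \<le> C * (v \<bullet> v)"
  proof -
    have "\<bar>N' u v \<bullet> v\<bar> \<le> norm (N' u v) * norm v" by (rule Cauchy_Schwarz_ineq2)
    also have "\<dots> \<le> (norm (N' u) * norm v) * norm v"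
      by (intro mult_right_mono norm_blinfun) auto
    also have "\<dots> \<le> (C * norm v) * norm v" using l(2) by (intro mult_right_mono) auto
    finally show ?thesis by (simp add: dot_square_norm power2_eq_square)
  qed
  ultimately have "\<bar>normal u \<bullet> a\<bar> * \<bar>N' u v \<bullet> v\<bar> \<le> 1 * (C * (v \<bullet> v))" by (intro mult_mono) auto
  then have "2 * (normal u \<bullet> a) * (N' u v \<bullet> v) \<le> 2 * C * (v \<bullet> v)"
    by (simp add: abs_mult[symmetric] abs_le_iff)
  also have "\<dots> < (1 / norm (u - x) + 1 / norm (bounce x u - u)) * (v \<bullet> v)"
    using big v(1) by (intro mult_strict_right_mono) auto
  finally have "length_hessian x u v v > 0"
    using av U(4)[OF l(3) u(1) nv] by (simp add: length_hessian_def a_def[symmetric])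
  then show ?thesis using u nv by blast
qed

text \<open>
  By the strict triangle inequality a third boundary point beats the value \<open>|x - y|\<close> attained at
  \<open>x\<close> and at \<open>y\<close>.
\<close>

lemma maximizer_exists:
  assumes x: "x \<in> \<Sigma>" and y: "y \<in> \<Sigma>" "x \<noteq> y" and dim: "DIM('a) \<ge> 2"
  obtains u where "u \<in> \<Sigma>" "x \<noteq> u" "y \<noteq> u" "\<And>p. p \<in> \<Sigma> \<Longrightarrow> dist x p + dist p y \<le> dist x u + dist u y"
proof -
  have "continuous_on \<Sigma> (\<lambda>p. dist x p + dist p y)" by (intro continuous_intros)
  then obtain u where u: "u \<in> \<Sigma>" "\<forall>p\<in>\<Sigma>. dist x p + dist p y \<le> dist x u + dist u y"
    using continuous_attains_sup[OF compact_boundary] x by blast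
  have "infinite \<Sigma>" using boundary_islimpt[OF x dim] islimpt_finite by blast
  then have "infinite (\<Sigma> - {x, y})" by simp
  then have "\<Sigma> - {x, y} \<noteq> {}" by (metis finite.emptyI)
  then obtain p where p: "p \<in> \<Sigma>" "p \<noteq> x" "p \<noteq> y" by blast
  have "p \<notin> closed_segment x y"
    using open_segment_interior[OF x y] p boundary_not_interior by (auto simp: open_segment_def)
  then have "dist x y \<noteq> dist x p + dist p y" by (metis between between_mem_segment)
  then have "dist x y < dist x p + dist p y" using dist_triangle[of x y p] by linarith
  then have "dist x y < dist x u + dist u y" using u(2) p(1) by fastforce
  then have "x \<noteq> u" "y \<noteq> u" by auto
  then show ?thesis using that u by blast
qed

lemma infinite_conjugate_orbits:
  assumes x: "x \<in> \<Sigma>" and dim: "DIM('a) > 2"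
  shows "infinite {u \<in> \<Sigma> - {x}. conjugate_points \<Sigma> (orbit x u) 0 2}" (is "infinite ?D")
proof
  assume fin: "finite ?D"
  define P where "P = {u \<in> \<Sigma> - {x}. \<exists>v. normal u \<bullet> v = 0 \<and> length_hessian x u v v > 0}"
  define N where "N = {u \<in> \<Sigma> - {x}. \<forall>v. v \<noteq> 0 \<and> normal u \<bullet> v = 0 \<longrightarrow> length_hessian x u v v < 0}"
  (* the points at which the form is semidefinite but not definite *)
  define E where "E = \<Sigma> - {x} - P - N"
  have "E \<subseteq> ?D"
  proof
    fix u assume u: "u \<in> E"
    then have uS: "u \<in> \<Sigma>" "x \<noteq> u" by (auto simp: E_def)
    have le: "length_hessian x u v v \<le> 0" if "normal u \<bullet> v = 0" for v
      using u that by (force simp: P_def E_def)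
    obtain v where v: "v \<noteq> 0" "normal u \<bullet> v = 0" "\<not> length_hessian x u v v < 0"
      using u by (auto simp: N_def E_def)
    have "length_hessian x u v v = 0" using le[OF v(2)] v(3) by linarith
    then have "length_hessian x u v w = 0" if "normal u \<bullet> w = 0" for w
      using semidefinite_kernel[OF uS(1) le v(2)] that by blast
    then show "u \<in> ?D" using conjugate_points_of_kernel[OF x uS v(1,2)] uS by auto
  qed
  then have finE: "finite E" using fin finite_subset by blast
  then have con: "connected (\<Sigma> - {x} - E)" by (rule connected_boundary_diff_finite[OF x dim])
  have PN: "P \<inter> N = {}"
  proof -
    have False if uP: "u \<in> P" and uN: "u \<in> N" for u
    proof -
      obtain v where v: "normal u \<bullet> v = 0" "length_hessian x u v v > 0" using uP by (auto simp: P_def)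
      then have "v \<noteq> 0" by (auto simp: length_hessian_def)
      then show False using v uN by (force simp: N_def)
    qed
    then show ?thesis by blast
  qed
  have C: "\<Sigma> - {x} - E = P \<union> N" by (auto simp: E_def P_def N_def)
  have oP: "openin (top_of_set (\<Sigma> - {x})) P" unfolding P_def by (rule openin_positive_direction[OF x])
  have oN: "openin (top_of_set (\<Sigma> - {x})) N" unfolding N_def by (rule openin_negative_definite[OF x])
  have "openin (top_of_set (P \<union> N)) P" "openin (top_of_set (P \<union> N)) N"
    by (rule openin_subset_trans[OF oP] openin_subset_trans[OF oN]; force simp: P_def N_def)+
  moreover have "P \<noteq> {}" using positive_direction_exists[OF x dim] by (auto simp: P_def)
  moreover have "N \<noteq> {}"
  proof
    (* the maximisers would all lie in the finite set E, but the bounce map sends them onto the rest of the boundary *)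
    assume "N = {}"
    have "\<exists>u. u \<in> E \<and> bounce x u = y" if y: "y \<in> \<Sigma> - {x}" for y
    proof -
      have y': "y \<in> \<Sigma>" "x \<noteq> y" using y by auto
      obtain u where u: "u \<in> \<Sigma>" "x \<noteq> u" "y \<noteq> u" "\<And>p. p \<in> \<Sigma> \<Longrightarrow> dist x p + dist p y \<le> dist x u + dist u y"
        by (rule maximizer_exists[OF x y']) (use dim in auto)
      have "u \<notin> P" using length_maximizer(2)[OF x y' u] by (force simp: P_def)
      then have "u \<in> E" using u \<open>N = {}\<close> by (auto simp: E_def)
      then show ?thesis using length_maximizer(1)[OF x y' u] by blast
    qed
    then have "\<Sigma> - {x} \<subseteq> bounce x ` E" by blast
    then have "finite (\<Sigma> - {x})" using finE finite_surj by blast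
    then have "finite \<Sigma>" by simp
    then show False using boundary_islimpt[OF x] dim islimpt_finite by fastforce
  qed
  ultimately show False
    using con PN unfolding C connected_openin by blast
qed

end

theorem theorem1p2:
  fixes K :: "'a::euclidean_space set" and x :: 'a
  assumes "DIM('a) > 2"
    and "strictly_convex_body K"
    and "C2_hypersurface (frontier K)"
    and "positive_curvature K"
    and "x \<in> frontier K"
  shows "infinite {X. billiard_configuration (frontier K) X \<and> X 0 = x \<and>
           (\<exists>N>0. conjugate_points (frontier K) X 0 N)}"
proof -
  interpret smooth_strictly_convex_body K using assms by unfold_locales
  let ?D = "{u \<in> \<Sigma> - {x}. conjugate_points \<Sigma> (orbit x u) 0 2}"
  have "inj_on (orbit x) ?D"
    by (rule inj_on_inverseI[where g = "\<lambda>X. X 1"]) simp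
  then have "infinite (orbit x ` ?D)"
    using infinite_conjugate_orbits[OF assms(5,1)] by (simp add: finite_image_iff)
  moreover have "orbit x ` ?D \<subseteq> {X. billiard_configuration \<Sigma> X \<and> X 0 = x \<and> (\<exists>N>0. conjugate_points \<Sigma> X 0 N)}"
  proof (rule image_subsetI)
    fix u assume u: "u \<in> ?D"
    then have "billiard_configuration \<Sigma> (orbit x u)"
      by (intro billiard_configuration_orbit assms(5)) auto
    moreover have "\<exists>N>0. conjugate_points \<Sigma> (orbit x u) 0 N"
      using u by (intro exI[of _ 2]) simp
    ultimately show "orbit x u \<in> {X. billiard_configuration \<Sigma> X \<and> X 0 = x \<and> (\<exists>N>0. conjugate_points \<Sigma> X 0 N)}"
      by simp
  qed
  ultimately show ?thesis using finite_subset by blast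
qed

end
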